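(* Let $\mathcal{C} = (c_n)_{n=0}^\infty$ be a sequence in $\mathbb{C}$, and let $r \in \mathbb{N}$. For integers $m,t\ge 0$ let $H_{m,t}$ denote the $(m+1)\times(m+1)$ Hankel matrix with entries from $(c_n)_{n=t}^{2m+t}$, i.e. with $(i,j)$ entry $c_{t+i+j-2}$ for $1\le i,j\le m+1$. Let $H_\infty$ be the infinite Hankel matrix with $(i,j)$ entry $c_{i+j-2}$ for $i,j\ge 1$. Then the following are equivalent. 1. The sequence $\mathcal{C}$ has moment rank $r$. 2. $\mathcal{C}$ satisfies a simple $r$-th order linear recurrence, and $r$ is the smallest positive integer so that $\mathcal{C}$ has this property. 3. $\det(H_{r-1,t})\neq 0$ for every $t\ge 0$, $\operatorname{null}(H_{r,0}) = 1$, $\ker(H_{r,t}) = \ker(H_{r,0})$ for every $t \geq 0$, and $\ker(H_{r,0})\not\subseteq \nabla_r$. 4. There exist $\alpha_1,\ldots,\alpha_r,\ \beta_1,\ldots,\beta_r,\ \lambda_1,\ldots,\lambda_r \in \mathbb{C} \setminus \{0\}$ so that, for each integer $t \geq 0$, $$\sum_{j=0}^{2r} \binom{2r}{j} c_{j+t}\, x^{2r-j} y^{j} = \sum_{j=1}^r \lambda_j (\beta_j/\alpha_j)^t (\alpha_j x + \beta_j y)^{2r}$$ as polynomials in $x,y$, and $\{\alpha_j/\beta_j\}_{j=1}^r$ is a set of $r$ distinct values. 5. The ordinary generating function $\Phi(z) = \sum_{n \geq 0} c_n z^n$ of $\mathcal{C}$ is a rational function with exactly $r$ simple poles. 6. The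 infinite Hankel matrix $H_\infty$ has rank $r$ and admits a non-degenerate Vandermonde decomposition. 7. The ideal $R_{\mathcal{C}}$ is radical, and the least degree of any nonzero element of it is $r$. 8. The sequence $\mathcal{C}$ is the moment sequence for a complex $r$-atomic measure on $\mathbb{C}$. 9. The algorithm MRANK applied to $\mathcal{C}$ returns the parameter $r$.
   Context: Moment rank: $\mathcal{C}=(c_n)_{n\ge 0}$ has moment rank $r$ if $r$ is the smallest positive integer so that there exist nonzero complex numbers $\alpha_1,\dots,\alpha_r$ and distinct nonzero complex numbers $\beta_1,\dots,\beta_r$ with $c_n=\sum_{i=1}^r \alpha_i \beta_i^{n+1}$ for all $n\ge 0$. Simple recurrence: an $r$-th order linear recurrence $\sum_{j=0}^r a_j c_{j+t} = 0$ (with $a_j\in\mathbb{C}$) satisfied by $(c_j)_{j \geq 0}$ for all $t\geq 0$ is simple if its characteristic polynomial $\sum_{j=0}^r a_j x^j$ has distinct roots. Discriminant variety: $\nabla_r$ is the closure of $\{(b_0,\dotsc,b_{r}) \in \mathbb{C}^{r+1} : f(x) = \sum_{i=0}^r b_i x^i \text{ has a repeated root}\}$. Also, $\operatorname{null}$ denotes nullity (dimension of the kernel). Non-degenerate Vandermonde decomposition: an $n\times n$ complex matrix $H$ ($n=\infty$ allowed) has a non-degenerate Vandermonde decomposition if there exist an $r\times n$ Vandermonde matrix $V$ (with $(i,j)$ entry $a_i^{j-1}$, $a_i\in\mathbb{C}$) with all entries nonzero and an $r\times r$ diagonal matrix $D$ so that $H = V^TDV$. Recurrence ideal: $R_{\mathcal{C}}=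 \{\sum_{j=0}^s a_j x^j : s\ge 0,\ a_j\in\mathbb{C},\ \sum_{j=0}^s a_j c_{j+t} = 0 \text{ for all }t\geq 0 \}$, an ideal of $\mathbb{C}[x]$. Measures: a complex measure on $\mathcal{X}$ (with a $\sigma$-algebra $\Sigma$) is a countably additive function $\Sigma\to\mathbb{C}$. The $t$-th moment of $\mu$ is $m_t=\int_{\mathcal{X}} x^t\,d\mu$, and $(m_t)_{t\ge 0}$ is its moment sequence. A measure is $r$-atomic if there exists $A\subset\mathcal{X}$ with $|A|=r$ so that $\mu(\{x\})\ne 0$ for $x\in A$ and $\mu(B)=0$ for every $B\in\Sigma$ with $B\subset\mathcal{X}\setminus A$. Algorithm MRANK, on input $\mathcal{C}=(c_n)_{n\ge 0}$: set $r=0$. Then: Step 1. $r\leftarrow r+1$. Step 2. Let $\mathbf{c}_t = (c_t,\ldots,c_{t+r-1})$ and let $\mathbf{C} = (\mathbf{c}_0^T, \ldots, \mathbf{c}_{r-1}^T)$ (an $r\times r$ matrix). Step 3. If $\det(\mathbf{C}) = 0$, go to Step 1; else continue. Step 4. Let $(a_0,\ldots,a_{r-1})^T = -\mathbf{C}^{-1} \mathbf{c}_r^T$ and define $p(x) = \sum_{n=0}^{r} a_n x^{n}$, where $a_r = 1$. Step 5. If $(c_n)_{n \geq 0}$ does not satisfy $\sum_{i=0}^{r} a_i c_{i+t} = 0$ for all $t \geq 0$, go to Step 1; else continue. Step 6. If $p$ has repeated roots, throw an error (not simple) and terminate; else continue. Step 7. Return $r$ and $\boldsymbol{\alpha} =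 (\mathbf{c}_0\, \mathrm{VDM}'(\boldsymbol{\beta})^{-1})^T$, where $\boldsymbol{\beta}=(\beta_1,\dots,\beta_r)$ is the vector of roots of $p$ and $\mathrm{VDM}'(\boldsymbol{\beta})$ is the $r\times r$ matrix with $(i,j)$ entry $\beta_i^{j}$. Each step (determinants, checking the recurrence, checking for repeated roots, finding roots) is assumed to be carried out correctly in finite time.
   Formalization: As literally stated this fails, e.g. for (1,0,0,…), (5,1,1,…) or 0. Added: in (2) the sequence is nonzero and the recurrence has a_0 ≠ 0; in (5) Φ vanishes at infinity; in (7) some element of R_C is nonzero at 0; in (8) the measure has no atom at 0. *)

theory Defs
  imports
    "HOL-Complex_Analysis.Complex_Analysis"
    "HOL-Library.Function_Algebras"
    "Jordan_Normal_Form.Matrix_Kernel"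
begin

(* From here on "$" is the indexing of the matrix library's vectors only. *)
unbundle no vec_syntax

hide_const (open) Determinants.det Cartesian_Space.vector Finite_Cartesian_Product.mat Finite_Cartesian_Product.vec
hide_type (open) Finite_Cartesian_Product.vec

definition exponential_sum :: "(nat \<Rightarrow> complex) \<Rightarrow> nat \<Rightarrow> bool" where
  "exponential_sum c r \<longleftrightarrow>
     (\<exists>\<alpha> \<beta> :: nat \<Rightarrow> complex.
        (\<forall>i\<in>{1..r}. \<alpha> i \<noteq> 0 \<and> \<beta> i \<noteq> 0) \<and> inj_on \<beta> {1..r} \<and>
        (\<forall>n. c n = (\<Sum>i=1..r. \<alpha> i * \<beta> i ^ (n + 1))))"

definition has_moment_rank :: "(nat \<Rightarrow> complex) \<Rightarrow> nat \<Rightarrow> bool" where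
  "has_moment_rank c r \<longleftrightarrow>
     r > 0 \<and> exponential_sum c r \<and> (\<forall>s>0. exponential_sum c s \<longrightarrow> r \<le> s)"

(* The zero polynomial has repeated roots; nonzero constants have none. *)
definition has_repeated_root :: "complex poly \<Rightarrow> bool" where
  "has_repeated_root p \<longleftrightarrow> (\<exists>z. [:-z, 1:]\<^sup>2 dvd p)"

definition satisfies_recurrence :: "(nat \<Rightarrow> complex) \<Rightarrow> nat \<Rightarrow> (nat \<Rightarrow> complex) \<Rightarrow> bool" where
  "satisfies_recurrence c r a \<longleftrightarrow> (\<forall>t. (\<Sum>j\<le>r. a j * c (j + t)) = 0)"

(* As usual, a recurrence has order r only if both extreme coefficients are nonzero: with
   a 0 = 0 it is a recurrence of lower order for a shift of c, and x is a factor of its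
   characteristic polynomial. *)
definition satisfies_simple_recurrence :: "(nat \<Rightarrow> complex) \<Rightarrow> nat \<Rightarrow> bool" where
  "satisfies_simple_recurrence c r \<longleftrightarrow>
     (\<exists>a. a 0 \<noteq> 0 \<and> a r \<noteq> 0 \<and> satisfies_recurrence c r a \<and>
          \<not> has_repeated_root (\<Sum>j\<le>r. monom (a j) j))"

definition hankel :: "(nat \<Rightarrow> complex) \<Rightarrow> nat \<Rightarrow> nat \<Rightarrow> complex mat" where
  "hankel c m t = Matrix.mat (m + 1) (m + 1) (\<lambda>(i, j). c (t + i + j))"

(* The complex space of dimension r + 1 is the product topology on extensional functions
   on {..r}. For this set the Euclidean and the Zariski closure coincide. *)
definition discriminant_variety :: "nat \<Rightarrow> (nat \<Rightarrow> complex) set" where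
  "discriminant_variety r =
     product_topology (\<lambda>_. euclidean) {..r} closure_of
       {b \<in> {..r} \<rightarrow>\<^sub>E UNIV. has_repeated_root (\<Sum>i\<le>r. monom (b i) i)}"

definition vec_coords :: "complex Matrix.vec \<Rightarrow> nat \<Rightarrow> complex" where
  "vec_coords v = (\<lambda>i\<in>{..<dim_vec v}. v $ i)"

(* Polynomials in x and y are polynomials in y over polynomials in x. *)
definition poly_const :: "complex \<Rightarrow> complex poly poly" where
  "poly_const a = [:[:a:]:]"

definition poly_x :: "complex poly poly" where
  "poly_x = [:[:0, 1:]:]"

definition poly_y :: "complex poly poly" where
  "poly_y = [:0, 1:]"

definition rational_function :: "(complex \<Rightarrow> complex) \<Rightarrow> bool" where
  "rational_function f \<longleftrightarrow> (\<exists>P Q. Q \<noteq> 0 \<and> f = (\<lambda>z. poly P z / poly Q z))"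

definition exactly_simple_poles :: "(complex \<Rightarrow> complex) \<Rightarrow> nat \<Rightarrow> bool" where
  "exactly_simple_poles f r \<longleftrightarrow>
     finite {z. is_pole f z} \<and> card {z. is_pole f z} = r \<and>
     (\<forall>z. is_pole f z \<longrightarrow> zorder f z = -1)"

(* Infinite matrices are functions of a row and a column index, both starting from 0. *)
definition hankel_inf :: "(nat \<Rightarrow> complex) \<Rightarrow> nat \<Rightarrow> nat \<Rightarrow> complex" where
  "hankel_inf c = (\<lambda>i j. c (i + j))"

interpretation complex_seq: vector_space "\<lambda>(a::complex) (f::nat \<Rightarrow> complex) n. a * f n"
  by unfold_locales (auto simp: fun_eq_iff algebra_simps)

(* The finiteness clause is needed because the dimension of a space without a finite
   basis is 0 by convention. *)
definition has_rank_inf :: "(nat \<Rightarrow> nat \<Rightarrow> complex) \<Rightarrow> nat \<Rightarrow> bool" where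
  "has_rank_inf H r \<longleftrightarrow>
     (\<exists>B. finite B \<and> range (\<lambda>j i. H i j) \<subseteq> complex_seq.span B) \<and>
     complex_seq.dim (range (\<lambda>j i. H i j)) = r"

definition vandermonde :: "(nat \<Rightarrow> complex) \<Rightarrow> nat \<Rightarrow> nat \<Rightarrow> complex" where
  "vandermonde a = (\<lambda>i j. a i ^ j)"

definition nondegenerate_vandermonde_decomposition :: "(nat \<Rightarrow> nat \<Rightarrow> complex) \<Rightarrow> bool" where
  "nondegenerate_vandermonde_decomposition H \<longleftrightarrow>
     (\<exists>s a D. D \<in> carrier_mat s s \<and> diagonal_mat D \<and>
        (\<forall>k<s. \<forall>j. vandermonde a k j \<noteq> 0) \<and>
        (\<forall>i j. H i j = (\<Sum>k<s. \<Sum>l<s. vandermonde a k i * D $$ (k, l) * vandermonde a l j)))"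

definition recurrence_ideal :: "(nat \<Rightarrow> complex) \<Rightarrow> complex poly set" where
  "recurrence_ideal c = {\<Sum>j\<le>s. monom (a j) j | s a. satisfies_recurrence c s a}"

definition radical_ideal :: "'a::comm_semiring_1 set \<Rightarrow> bool" where
  "radical_ideal I \<longleftrightarrow> {p. \<exists>n>0. p ^ n \<in> I} = I"

(* M only provides the underlying measurable space. *)
definition complex_measure :: "'a measure \<Rightarrow> ('a set \<Rightarrow> complex) \<Rightarrow> bool" where
  "complex_measure M \<mu> \<longleftrightarrow>
     (\<forall>A::nat \<Rightarrow> 'a set. range A \<subseteq> sets M \<and> disjoint_family A \<longrightarrow>
        (\<lambda>n. \<mu> (A n)) sums \<mu> (\<Union>n. A n))"

(* The integral against a complex measure, by way of a decomposition
   \<nu> 0 + i * \<nu> 1 - \<nu> 2 - i * \<nu> 3 into finite positive measures. The value does not depend on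
   the decomposition, and a suitable one exists iff f is integrable for the total
   variation of \<mu>. *)
definition has_complex_integral ::
    "'a measure \<Rightarrow> ('a set \<Rightarrow> complex) \<Rightarrow> ('a \<Rightarrow> complex) \<Rightarrow> complex \<Rightarrow> bool" where
  "has_complex_integral M \<mu> f I \<longleftrightarrow>
     (\<exists>\<nu> :: nat \<Rightarrow> 'a measure.
        (\<forall>k<4. sets (\<nu> k) = sets M \<and> finite_measure (\<nu> k) \<and> integrable (\<nu> k) f) \<and>
        (\<forall>B\<in>sets M. \<mu> B = (\<Sum>k<4. \<i> ^ k * complex_of_real (measure (\<nu> k) B))) \<and>
        I = (\<Sum>k<4. \<i> ^ k * (\<integral>x. f x \<partial>\<nu> k)))"

definition atomic_measure :: "'a measure \<Rightarrow> ('a set \<Rightarrow> complex) \<Rightarrow> nat \<Rightarrow> bool" where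
  "atomic_measure M \<mu> r \<longleftrightarrow>
     (\<exists>A\<subseteq>space M. finite A \<and> card A = r \<and> (\<forall>x\<in>A. \<mu> {x} \<noteq> 0) \<and>
        (\<forall>B\<in>sets M. B \<subseteq> space M - A \<longrightarrow> \<mu> B = 0))"

definition moment_sequence_of :: "(complex set \<Rightarrow> complex) \<Rightarrow> (nat \<Rightarrow> complex) \<Rightarrow> bool" where
  "moment_sequence_of \<mu> c \<longleftrightarrow> (\<forall>t. has_complex_integral borel \<mu> (\<lambda>x. x ^ t) (c t))"

definition mrank_vec :: "(nat \<Rightarrow> complex) \<Rightarrow> nat \<Rightarrow> nat \<Rightarrow> complex Matrix.vec" where
  "mrank_vec c r t = Matrix.vec r (\<lambda>i. c (t + i))"

definition mrank_mat :: "(nat \<Rightarrow> complex) \<Rightarrow> nat \<Rightarrow> complex mat" where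
  "mrank_mat c r = mat_of_cols r (map (mrank_vec c r) [0..<r])"

(* The coefficients of p. The inverse exists whenever the determinant test was passed. *)
definition mrank_coeff :: "(nat \<Rightarrow> complex) \<Rightarrow> nat \<Rightarrow> nat \<Rightarrow> complex" where
  "mrank_coeff c r n =
     (if n < r then (- (the (mat_inverse (mrank_mat c r)) *\<^sub>v mrank_vec c r r)) $ n else 1)"

definition mrank_poly :: "(nat \<Rightarrow> complex) \<Rightarrow> nat \<Rightarrow> complex poly" where
  "mrank_poly c r = (\<Sum>n\<le>r. monom (mrank_coeff c r n) n)"

datatype mrank_result = Not_Simple | Returned nat "complex Matrix.vec"

(* Big-step semantics of the loop: mrank_loop c r res says that the execution which enters
   the loop body with counter r terminates with result res. The roots may be listed in any
   order. In the last rule the matrix has to be invertible for a result to be returned. *)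
inductive mrank_loop :: "(nat \<Rightarrow> complex) \<Rightarrow> nat \<Rightarrow> mrank_result \<Rightarrow> bool" for c where
  singular:
    "Determinant.det (mrank_mat c r) = 0 \<Longrightarrow> mrank_loop c (r + 1) res \<Longrightarrow> mrank_loop c r res"
| no_recurrence:
    "Determinant.det (mrank_mat c r) \<noteq> 0 \<Longrightarrow>
     \<not> satisfies_recurrence c r (mrank_coeff c r) \<Longrightarrow>
     mrank_loop c (r + 1) res \<Longrightarrow> mrank_loop c r res"
| not_simple:
    "Determinant.det (mrank_mat c r) \<noteq> 0 \<Longrightarrow>
     satisfies_recurrence c r (mrank_coeff c r) \<Longrightarrow>
     has_repeated_root (mrank_poly c r) \<Longrightarrow> mrank_loop c r Not_Simple"
| returned:
    "Determinant.det (mrank_mat c r) \<noteq> 0 \<Longrightarrow>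
     satisfies_recurrence c r (mrank_coeff c r) \<Longrightarrow>
     \<not> has_repeated_root (mrank_poly c r) \<Longrightarrow>
     distinct \<beta> \<Longrightarrow> set \<beta> = {z. poly (mrank_poly c r) z = 0} \<Longrightarrow>
     mat_inverse (Matrix.mat r r (\<lambda>(i, j). \<beta> ! i ^ (j + 1))) = Some W \<Longrightarrow>
     mrank_loop c r (Returned r (transpose_mat W *\<^sub>v mrank_vec c r 0))"

definition mrank :: "(nat \<Rightarrow> complex) \<Rightarrow> mrank_result \<Rightarrow> bool" where
  "mrank c res \<longleftrightarrow> mrank_loop c 1 res"

end

theory Submission
  imports
    Defs
    "HOL-Computational_Algebra.Fundamental_Theorem_Algebra"
    "HOL-Computational_Algebra.Field_as_Ring"
begin

text \<open>
  A sequence has moment rank \<open>r\<close> iff it is a combination of the geometric sequences of \<open>r\<close> distinct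
  nonzero ratios, forming a set \<open>S\<close>, with nonzero weights. Polynomials act on sequences, \<open>x\<close> acting
  as the left shift, and on such a combination \<open>p\<close> multiplies the weight of \<open>\<beta>\<close> by \<open>p(\<beta>)\<close>. As
  geometric sequences are independent, the annihilator is generated by \<open>\<Prod>\<beta>\<in>S. (x - \<beta>)\<close>.
  Conversely, a square-free annihilator that does not vanish at \<open>0\<close> produces a set \<open>S\<close> within its
  roots, which are all needed when no nonzero annihilator has smaller degree. Each condition
  provides such a minimal annihilator, or the combination itself.
\<close>

section \<open>The shift action of polynomials on sequences\<close>

text \<open>The obstacle common to all conditions is the ratio 0. The sequence 1, 0, 0, ... is
  annihilated by the square-free polynomial x and consists of the moments of a unit atom at 0, yet
  it has no moment rank. Each condition has to exclude it in its own way: by a nonzero constant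
  coefficient of the recurrence or of some member of the ideal, by the Hankel determinant of the
  shifted sequence, by nonzero Vandermonde entries, by a generating function that vanishes at
  infinity and so has no polynomial part, by the absence of mass at 0, or, in the algorithm, by a
  root matrix whose exponents start at 1. Minimality of the degree also needs a certificate that
  differs from case to case: a nonsingular Hankel matrix, a fraction in lowest terms, or a
  minimality clause in the condition itself.\<close>

definition poly_action :: "complex poly \<Rightarrow> (nat \<Rightarrow> complex) \<Rightarrow> nat \<Rightarrow> complex" where
  "poly_action p c t = (\<Sum>j\<le>degree p. coeff p j * c (j + t))"

definition annihilates :: "complex poly \<Rightarrow> (nat \<Rightarrow> complex) \<Rightarrow> bool" where
  "annihilates p c \<longleftrightarrow> (\<forall>t. poly_action p c t = 0)"

text \<open>The moment rank is the cardinality of \<open>S\<close>; the weight \<open>w \<beta>\<close> is \<open>\<alpha>\<^sub>i * \<beta>\<^sub>i\<close> in the notation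
  of \<^const>\<open>exponential_sum\<close>. The empty set represents the zero sequence.\<close>

definition exp_rep :: "(nat \<Rightarrow> complex) \<Rightarrow> complex set \<Rightarrow> (complex \<Rightarrow> complex) \<Rightarrow> bool" where
  "exp_rep c S w \<longleftrightarrow> finite S \<and> 0 \<notin> S \<and> (\<forall>\<beta>\<in>S. w \<beta> \<noteq> 0) \<and>
     (\<forall>n. c n = (\<Sum>\<beta>\<in>S. w \<beta> * \<beta> ^ n))"

definition root_poly :: "complex set \<Rightarrow> complex poly" where
  "root_poly S = (\<Prod>\<beta>\<in>S. [:-\<beta>, 1:])"

text \<open>Degrees change under sums and cancellation, so the algebraic laws are proved with a
  common upper summation bound.\<close>

lemma poly_action_upto:
  assumes "degree p \<le> n"
  shows "poly_action p c t = (\<Sum>j\<le>n. coeff p j * c (j + t))"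
  unfolding poly_action_def using assms
  by (intro sum.mono_neutral_left) (auto simp: coeff_eq_0)

lemma poly_action_0 [simp]: "poly_action 0 c t = 0"
  by (simp add: poly_action_def)

lemma poly_action_pCons: "poly_action (pCons a p) c t = a * c t + poly_action p c (Suc t)"
proof -
  have "poly_action (pCons a p) c t = (\<Sum>j\<le>Suc (degree p). coeff (pCons a p) j * c (j + t))"
    by (rule poly_action_upto) (simp add: degree_pCons_le)
  also have "\<dots> = a * c t + poly_action p c (Suc t)"
    by (simp only: sum.atMost_Suc_shift poly_action_def) simp
  finally show ?thesis .
qed

lemma poly_action_add: "poly_action (p + q) c t = poly_action p c t + poly_action q c t"
proof -
  let ?n = "max (degree p) (degree q)"
  have "degree (p + q) \<le> ?n" "degree p \<le> ?n" "degree q \<le> ?n"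
    by (auto simp: degree_add_le_max)
  then show ?thesis
    by (simp only: poly_action_upto[where n = ?n] coeff_add distrib_right sum.distrib)
qed

lemma poly_action_smult: "poly_action (Polynomial.smult a p) c t = a * poly_action p c t"
  by (simp add: poly_action_upto[OF degree_smult_le] poly_action_def sum_distrib_left mult.assoc)

lemma poly_action_mult: "poly_action (p * q) c t = poly_action p (poly_action q c) t"
  by (induction p arbitrary: t)
    (simp_all add: poly_action_pCons poly_action_add poly_action_smult)

lemma annihilates_mult:
  assumes "annihilates p c"
  shows "annihilates (q * p) c"
proof -
  have "poly_action p c = (\<lambda>_. 0)"
    using assms by (auto simp: annihilates_def)
  then show ?thesis
    by (simp add: annihilates_def poly_action_mult) (simp add: poly_action_def)
qed

lemma annihilates_diff:
  assumes "annihilates p c" "annihilates q c"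
  shows "annihilates (p - q) c"
proof -
  have "annihilates (p + Polynomial.smult (-1) q) c"
    using assms by (simp only: annihilates_def poly_action_add poly_action_smult) simp
  then show ?thesis
    by simp
qed

lemma annihilates_smult:
  "annihilates p c \<Longrightarrow> annihilates (Polynomial.smult a p) c"
  by (simp add: annihilates_def poly_action_smult)

lemma coeff_sum_monom:
  "coeff (\<Sum>j\<le>s. monom (a j) j) i = (if i \<le> s then a i else 0)"
  by (simp add: coeff_sum)

lemma degree_sum_monom_le: "degree (\<Sum>j\<le>s. monom (a j) j) \<le> s"
  by (rule degree_le) (simp add: coeff_sum_monom)

lemma sum_monom_coeff:
  assumes "degree p \<le> s"
  shows "(\<Sum>j\<le>s. monom (coeff p j) j) = p"
  using assms by (auto intro!: poly_eqI simp: coeff_sum_monom coeff_eq_0)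

lemma poly_action_sum_monom:
  "poly_action (\<Sum>j\<le>s. monom (a j) j) c t = (\<Sum>j\<le>s. a j * c (j + t))"
  by (simp add: poly_action_upto[OF degree_sum_monom_le] coeff_sum_monom)

lemma satisfies_recurrence_iff:
  "satisfies_recurrence c s a \<longleftrightarrow> annihilates (\<Sum>j\<le>s. monom (a j) j) c"
  by (simp add: satisfies_recurrence_def annihilates_def poly_action_sum_monom)

lemma recurrence_ideal_eq: "recurrence_ideal c = {p. annihilates p c}"
proof (intro equalityI subsetI CollectI)
  fix p assume "p \<in> {p. annihilates p c}"
  then show "p \<in> recurrence_ideal c"
    unfolding recurrence_ideal_def satisfies_recurrence_iff
    using sum_monom_coeff[of p "degree p", symmetric] by force
qed (auto simp: recurrence_ideal_def satisfies_recurrence_iff)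

section \<open>Monic polynomials with prescribed simple roots\<close>

lemma root_poly_nonzero [simp]: "root_poly S \<noteq> 0"
  by (cases "finite S") (auto simp: root_poly_def)

lemma degree_root_poly [simp]:
  assumes "finite S"
  shows "degree (root_poly S) = card S"
  using assms unfolding root_poly_def by (subst degree_prod_eq_sum_degree) auto

lemma lead_coeff_root_poly [simp]: "lead_coeff (root_poly S) = 1"
  by (simp add: root_poly_def lead_coeff_prod)

lemma poly_root_poly [simp]:
  assumes "finite S"
  shows "poly (root_poly S) z = 0 \<longleftrightarrow> z \<in> S"
  using assms by (auto simp: root_poly_def poly_prod)

lemma root_poly_dvd:
  assumes "finite S" "\<And>\<beta>. \<beta> \<in> S \<Longrightarrow> poly p \<beta> = 0"
  shows "root_poly S dvd p"
  using assms
proof (induction S arbitrary: p rule: finite_induct)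
  case empty
  then show ?case by (simp add: root_poly_def)
next
  case (insert b S)
  from insert.prems[of b] obtain q where q: "p = [:-b, 1:] * q"
    by (auto simp: poly_eq_0_iff_dvd)
  have "poly q \<beta> = 0" if "\<beta> \<in> S" for \<beta>
    using insert.prems[of \<beta>] insert.hyps that by (auto simp: q)
  then have "root_poly S dvd q"
    by (rule insert.IH)
  then show ?case
    using insert.hyps by (simp add: root_poly_def q mult_dvd_mono del: mult_pCons_left)
qed

text \<open>Both notions count the zero polynomial as not square-free, so no exception
  arises.\<close>

lemma not_has_repeated_root_iff: "\<not> has_repeated_root p \<longleftrightarrow> rsquarefree p"
proof (cases "p = 0")
  case False
  then show ?thesis
    unfolding has_repeated_root_def rsquarefree_def
    by (simp add: order_divides) (metis One_nat_def Suc_1 less_2_cases_iff not_less)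
qed (simp add: has_repeated_root_def rsquarefree_def)

lemma rsquarefree_root_poly:
  assumes "finite S"
  shows "rsquarefree (root_poly S)"
proof -
  have "\<not> [:-z, 1:]\<^sup>2 dvd root_poly S" for z
  proof
    assume dvd: "[:-z, 1:]\<^sup>2 dvd root_poly S"
    then have "poly (root_poly S) z = 0"
      by (metis dvd_mult_left poly_eq_0_iff_dvd power2_eq_square)
    then have z: "z \<in> S"
      using assms by simp
    \<comment> \<open>After one factor is cancelled, the remaining product runs over
      \<open>S - {z}\<close> and cannot vanish at \<open>z\<close>.\<close>
    then have "root_poly S = [:-z, 1:] * root_poly (S - {z})"
      unfolding root_poly_def using assms by (simp add: prod.remove del: mult_pCons_left)
    then have "[:-z, 1:] * [:-z, 1:] dvd [:-z, 1:] * root_poly (S - {z})"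
      using dvd by (simp only: power2_eq_square)
    then have "[:-z, 1:] dvd root_poly (S - {z})"
      by (subst (asm) dvd_mult_cancel_left) simp
    then show False
      using assms by (simp add: poly_eq_0_iff_dvd[symmetric])
  qed
  then show ?thesis
    using not_has_repeated_root_iff has_repeated_root_def by blast
qed

lemma rsquarefree_eq_root_poly:
  assumes "rsquarefree p"
  shows "p = Polynomial.smult (lead_coeff p) (root_poly {z. poly p z = 0})"
  using complex_poly_decompose_rsquarefree[OF assms] by (simp add: root_poly_def)

lemma rsquarefree_card_roots:
  fixes p :: "complex poly"
  assumes "rsquarefree p"
  shows "card {z. poly p z = 0} = degree p"
proof -
  have "p \<noteq> 0"
    using assms by (simp add: rsquarefree_def)
  then have "finite {z. poly p z = 0}"
    by (rule poly_roots_finite)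
  then show ?thesis
    using arg_cong[OF rsquarefree_eq_root_poly[OF assms], of degree] \<open>p \<noteq> 0\<close> by simp
qed

section \<open>Independence of geometric sequences, and annihilators of their combinations\<close>

lemma power_sums_zero:
  fixes w :: "complex \<Rightarrow> complex"
  assumes "finite S" "\<And>i. i < card S \<Longrightarrow> (\<Sum>\<beta>\<in>S. w \<beta> * \<beta> ^ i) = 0" "b \<in> S"
  shows "w b = 0"
proof -
  \<comment> \<open>The Lagrange numerator for \<open>b\<close>: it vanishes on \<open>S\<close>
    except at \<open>b\<close>, and its degree \<open>card S - 1\<close> keeps all occurring power
    sums within the assumption.\<close>
  let ?p = "root_poly (S - {b})"
  have deg: "degree ?p < card S"
    using assms(1,3) card_gt_0_iff[of S] by auto
  have "(\<Sum>\<beta>\<in>S. w \<beta> * poly ?p \<beta>)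
      = (\<Sum>\<beta>\<in>S. \<Sum>i\<le>degree ?p. coeff ?p i * (w \<beta> * \<beta> ^ i))"
    by (simp add: poly_altdef sum_distrib_left mult_ac)
  also have "\<dots> = (\<Sum>i\<le>degree ?p. coeff ?p i * (\<Sum>\<beta>\<in>S. w \<beta> * \<beta> ^ i))"
    by (subst sum.swap) (simp add: sum_distrib_left)
  also have "\<dots> = 0"
    using deg assms(2) by (intro sum.neutral) auto
  finally have "(\<Sum>\<beta>\<in>S. w \<beta> * poly ?p \<beta>) = 0" .
  moreover have "(\<Sum>\<beta>\<in>S. w \<beta> * poly ?p \<beta>) = w b * poly ?p b"
    using assms(1,3) by (subst sum.remove[of _ b]) (auto intro!: sum.neutral)
  ultimately show ?thesis
    using assms(1) by simp
qed

lemma exp_rep_action: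
  assumes "exp_rep c S w"
  shows "poly_action p c t = (\<Sum>\<beta>\<in>S. w \<beta> * poly p \<beta> * \<beta> ^ t)"
proof -
  have c: "c n = (\<Sum>\<beta>\<in>S. w \<beta> * \<beta> ^ n)" for n
    using assms by (simp add: exp_rep_def)
  have "poly_action p c t = (\<Sum>j\<le>degree p. \<Sum>\<beta>\<in>S. w \<beta> * \<beta> ^ t * (coeff p j * \<beta> ^ j))"
    by (simp add: poly_action_def c sum_distrib_left power_add mult_ac)
  also have "\<dots> = (\<Sum>\<beta>\<in>S. w \<beta> * poly p \<beta> * \<beta> ^ t)"
    by (subst sum.swap) (simp add: sum_distrib_left poly_altdef mult_ac)
  finally show ?thesis .
qed

text \<open>The action of \<open>p\<close> only changes the weights, so \<open>card S\<close>
  consecutive zeros, starting anywhere, kill every new weight; \<open>b ^ t\<close> can be cancelled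
  because 0 is not in \<open>S\<close>. This is how a finite window tests for an
  annihilator.\<close>

lemma exp_rep_vanish:
  assumes "exp_rep c S w" "\<And>i. i < card S \<Longrightarrow> poly_action p c (t + i) = 0" "b \<in> S"
  shows "poly p b = 0"
proof -
  have "(\<Sum>\<beta>\<in>S. (w \<beta> * poly p \<beta> * \<beta> ^ t) * \<beta> ^ i) = 0" if "i < card S" for i
    using assms(2)[OF that] by (simp add: exp_rep_action[OF assms(1)] power_add mult_ac)
  then have "w b * poly p b * b ^ t = 0"
    using assms(1,3) power_sums_zero[of S "\<lambda>\<beta>. w \<beta> * poly p \<beta> * \<beta> ^ t" b]
    by (simp add: exp_rep_def)
  then show ?thesis
    using assms by (auto simp: exp_rep_def)
qed

lemma annihilates_exp_rep_iff:
  assumes "exp_rep c S w"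
  shows "annihilates p c \<longleftrightarrow> (\<forall>\<beta>\<in>S. poly p \<beta> = 0)"
proof
  assume "annihilates p c"
  then show "\<forall>\<beta>\<in>S. poly p \<beta> = 0"
    using exp_rep_vanish[OF assms, of p 0] by (simp add: annihilates_def)
qed (simp add: annihilates_def exp_rep_action[OF assms])

lemma exp_rep_annihilates_dvd:
  assumes "exp_rep c S w"
  shows "annihilates p c \<longleftrightarrow> root_poly S dvd p"
proof
  show "root_poly S dvd p" if "annihilates p c"
    using that assms annihilates_exp_rep_iff[OF assms, of p]
    by (intro root_poly_dvd) (auto simp: exp_rep_def)
  show "annihilates p c" if "root_poly S dvd p"
    using that assms annihilates_exp_rep_iff[OF assms, of p] by (auto simp: exp_rep_def elim!: dvdE)
qed

text \<open>The two root polynomials divide each other. Hence the minimality demanded of the moment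
  rank holds automatically for every representation.\<close>

lemma exp_rep_unique_card:
  assumes "exp_rep c S w" "exp_rep c T v"
  shows "card S = card T"
proof -
  have "finite S" "finite T"
    using assms by (auto simp: exp_rep_def)
  moreover have "root_poly S dvd root_poly T" "root_poly T dvd root_poly S"
    using exp_rep_annihilates_dvd[OF assms(1), of "root_poly S"]
      exp_rep_annihilates_dvd[OF assms(2), of "root_poly S"]
      exp_rep_annihilates_dvd[OF assms(1), of "root_poly T"]
      exp_rep_annihilates_dvd[OF assms(2), of "root_poly T"] by simp_all
  ultimately show ?thesis
    by (metis degree_root_poly dvd_imp_degree_le le_antisym root_poly_nonzero)
qed

text \<open>One root is peeled off: acting with x - b leaves a sequence covered by the induction
  hypothesis, and \<open>c\<close> is recovered from it up to a multiple of the geometric sequence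
  of b. Weights may still vanish here.\<close>

lemma root_poly_solution:
  assumes "finite S" "annihilates (root_poly S) c"
  shows "\<exists>w. \<forall>n. c n = (\<Sum>\<beta>\<in>S. w \<beta> * \<beta> ^ n)"
  using assms
proof (induction S arbitrary: c rule: finite_induct)
  case empty
  then show ?case
    by (auto simp: root_poly_def annihilates_def poly_action_def)
next
  case (insert b S)
  let ?d = "\<lambda>n. c (Suc n) - b * c n"
  have "poly_action [:-b, 1:] c = ?d"
    by (auto simp: poly_action_pCons fun_eq_iff)
  moreover have "root_poly (insert b S) = root_poly S * [:-b, 1:]"
    using insert.hyps by (simp add: root_poly_def mult.commute del: mult_pCons_left mult_pCons_right)
  ultimately have "annihilates (root_poly S) ?d"
    using insert.prems by (simp add: annihilates_def poly_action_mult del: mult_pCons_right)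
  then obtain w where w: "\<And>n. ?d n = (\<Sum>\<beta>\<in>S. w \<beta> * \<beta> ^ n)"
    using insert.IH by blast
  \<comment> \<open>Acting with x - b multiplies the weight of \<open>\<beta>\<close> by
    \<open>\<beta> - b\<close>, which is nonzero on \<open>S\<close>; this division undoes
    it.\<close>
  define v where "v \<beta> = w \<beta> / (\<beta> - b)" for \<beta>
  have v: "v \<beta> * (\<beta> - b) = w \<beta>" if "\<beta> \<in> S" for \<beta>
    using that insert.hyps by (auto simp: v_def)
  define e where "e n = c n - (\<Sum>\<beta>\<in>S. v \<beta> * \<beta> ^ n)" for n
  have "e (Suc n) = b * e n" for n
  proof -
    have "e (Suc n) - b * e n = ?d n - (\<Sum>\<beta>\<in>S. (v \<beta> * (\<beta> - b)) * \<beta> ^ n)"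
      by (simp add: e_def algebra_simps sum_distrib_left sum_subtractf)
    then show ?thesis
      using v w by simp
  qed
  then have e: "e n = e 0 * b ^ n" for n
    by (induction n) auto
  show ?case
  proof (intro exI allI)
    fix n
    show "c n = (\<Sum>\<beta>\<in>insert b S. (v(b := e 0)) \<beta> * \<beta> ^ n)"
      using e[of n] insert.hyps by (auto simp: e_def algebra_simps intro!: sum.cong)
  qed
qed

lemma exp_rep_drop_zero:
  assumes "finite S" "0 \<notin> S" "\<And>n. c n = (\<Sum>\<beta>\<in>S. w \<beta> * \<beta> ^ n)"
  shows "exp_rep c {\<beta>\<in>S. w \<beta> \<noteq> 0} w"
  using assms unfolding exp_rep_def
  by (auto intro!: sum.mono_neutral_right)

lemma annihilates_imp_exp_rep:
  assumes "annihilates p c" "rsquarefree p" "poly p 0 \<noteq> 0"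
  obtains S w where "exp_rep c S w" "card S \<le> degree p"
proof -
  let ?Z = "{z. poly p z = 0}"
  have p0: "p \<noteq> 0"
    using assms(3) by auto
  then have fin: "finite ?Z"
    by (rule poly_roots_finite)
  have "annihilates (root_poly ?Z) c"
  proof -
    have "root_poly ?Z = Polynomial.smult (inverse (lead_coeff p)) p"
      using arg_cong[OF rsquarefree_eq_root_poly[OF assms(2)], of "Polynomial.smult (inverse (lead_coeff p))"] p0
      by simp
    then show ?thesis
      using assms(1) by (simp add: annihilates_smult)
  qed
  then obtain w where "\<forall>n. c n = (\<Sum>\<beta>\<in>?Z. w \<beta> * \<beta> ^ n)"
    using root_poly_solution[OF fin] by blast
  then have "exp_rep c {\<beta>\<in>?Z. w \<beta> \<noteq> 0} w"
    using fin assms(3) by (intro exp_rep_drop_zero) auto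
  moreover have "card {\<beta>\<in>?Z. w \<beta> \<noteq> 0} \<le> degree p"
    using card_mono[OF fin, of "{\<beta>\<in>?Z. w \<beta> \<noteq> 0}"] rsquarefree_card_roots[OF assms(2)] by auto
  ultimately show ?thesis
    using that by blast
qed

text \<open>If a root of \<open>p\<close> were lost because its weight is zero,
  \<open>root_poly S\<close> would be an annihilator of too small degree.\<close>

lemma minimal_annihilates_imp_exp_rep:
  assumes "annihilates p c" "rsquarefree p" "poly p 0 \<noteq> 0"
    and "\<And>q. q \<noteq> 0 \<Longrightarrow> annihilates q c \<Longrightarrow> degree p \<le> degree q"
  obtains S w where "exp_rep c S w" "card S = degree p"
proof -
  obtain S w where S: "exp_rep c S w" "card S \<le> degree p"
    using annihilates_imp_exp_rep[OF assms(1-3)] .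
  moreover have "degree p \<le> card S"
    using assms(4)[of "root_poly S"] S exp_rep_annihilates_dvd[OF S(1)]
    by (auto simp: exp_rep_def)
  ultimately show ?thesis
    using that by auto
qed

lemma exponential_sum_iff: "exponential_sum c r \<longleftrightarrow> (\<exists>S w. exp_rep c S w \<and> card S = r)"
proof
  assume "exponential_sum c r"
  then obtain \<alpha> \<beta> where ab: "\<forall>i\<in>{1..r}. \<alpha> i \<noteq> 0 \<and> \<beta> i \<noteq> 0" "inj_on \<beta> {1..r}"
    "\<And>n. c n = (\<Sum>i=1..r. \<alpha> i * \<beta> i ^ (n + 1))"
    by (auto simp: exponential_sum_def)
  define w where "w z = \<alpha> (the_inv_into {1..r} \<beta> z) * z" for z
  have w: "w (\<beta> i) = \<alpha> i * \<beta> i" if "i \<in> {1..r}" for i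
    using the_inv_into_f_f[OF ab(2) that] by (simp add: w_def)
  have "exp_rep c (\<beta> ` {1..r}) w"
    unfolding exp_rep_def using ab w by (auto simp: sum.reindex mult.assoc)
  moreover have "card (\<beta> ` {1..r}) = r"
    using ab(2) by (simp add: card_image)
  ultimately show "\<exists>S w. exp_rep c S w \<and> card S = r"
    by blast
next
  assume "\<exists>S w. exp_rep c S w \<and> card S = r"
  then obtain S w where S: "exp_rep c S w" "card S = r"
    by blast
  then have "finite S"
    by (simp add: exp_rep_def)
  then obtain \<beta> where "bij_betw \<beta> {1..card S} S"
    using finite_same_card_bij[of "{1..card S}" S] by auto
  then have \<beta>: "bij_betw \<beta> {1..r} S"
    by (simp add: S)
  show "exponential_sum c r"
    unfolding exponential_sum_def
  proof (intro exI conjI)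
    show "\<forall>i\<in>{1..r}. w (\<beta> i) / \<beta> i \<noteq> 0 \<and> \<beta> i \<noteq> 0"
      using S \<beta> by (auto simp: exp_rep_def bij_betw_def)
    show "inj_on \<beta> {1..r}"
      using \<beta> by (simp add: bij_betw_def)
    have "\<beta> i \<noteq> 0" if "i \<in> {1..r}" for i
      using S \<beta> that by (auto simp: exp_rep_def bij_betw_def)
    then show "\<forall>n. c n = (\<Sum>i=1..r. w (\<beta> i) / \<beta> i * \<beta> i ^ (n + 1))"
      using S by (simp add: exp_rep_def sum.reindex_bij_betw[OF \<beta>, symmetric])
  qed
qed

lemma has_moment_rank_iff:
  assumes "r \<ge> 1"
  shows "has_moment_rank c r \<longleftrightarrow> (\<exists>S w. exp_rep c S w \<and> card S = r)"
proof
  assume "\<exists>S w. exp_rep c S w \<and> card S = r"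
  then obtain S w where "exp_rep c S w" "card S = r"
    by blast
  then show "has_moment_rank c r"
    using assms exp_rep_unique_card[of c S w] unfolding has_moment_rank_def exponential_sum_iff
    by (metis less_eq_Suc_le One_nat_def order_refl)
qed (simp add: has_moment_rank_def exponential_sum_iff)

section \<open>Simple recurrences and the recurrence ideal\<close>

lemma satisfies_simple_recurrence_iff:
  "satisfies_simple_recurrence c s \<longleftrightarrow>
     (\<exists>p. degree p = s \<and> poly p 0 \<noteq> 0 \<and> annihilates p c \<and> rsquarefree p)"
proof
  assume "satisfies_simple_recurrence c s"
  then obtain a where a: "a 0 \<noteq> 0" "a s \<noteq> 0" "satisfies_recurrence c s a"
    "\<not> has_repeated_root (\<Sum>j\<le>s. monom (a j) j)"
    by (auto simp: satisfies_simple_recurrence_def)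
  let ?p = "\<Sum>j\<le>s. monom (a j) j"
  have "degree ?p = s"
    using a(2) by (intro antisym degree_sum_monom_le le_degree) (simp add: coeff_sum_monom)
  moreover have "poly ?p 0 \<noteq> 0"
    using a(1) by (simp add: poly_0_coeff_0 coeff_sum_monom)
  ultimately show "\<exists>p. degree p = s \<and> poly p 0 \<noteq> 0 \<and> annihilates p c \<and> rsquarefree p"
    using a(3,4) satisfies_recurrence_iff not_has_repeated_root_iff by blast
next
  assume "\<exists>p. degree p = s \<and> poly p 0 \<noteq> 0 \<and> annihilates p c \<and> rsquarefree p"
  then obtain p where p: "degree p = s" "poly p 0 \<noteq> 0" "annihilates p c" "rsquarefree p"
    by blast
  moreover have "coeff p s \<noteq> 0"
    using p by auto
  ultimately show "satisfies_simple_recurrence c s"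
    unfolding satisfies_simple_recurrence_def satisfies_recurrence_iff not_has_repeated_root_iff
    by (intro exI[of _ "coeff p"]) (simp add: sum_monom_coeff poly_0_coeff_0)
qed

lemma exp_rep_nonzero:
  assumes "exp_rep c S w" "S \<noteq> {}"
  shows "\<exists>n. c n \<noteq> 0"
proof (rule ccontr)
  assume "\<nexists>n. c n \<noteq> 0"
  then have "annihilates 1 c"
    by (simp add: annihilates_def poly_action_def)
  then show False
    using assms annihilates_exp_rep_iff[OF assms(1), of 1] by auto
qed

lemma exp_rep_simple_recurrence:
  assumes "exp_rep c S w"
  shows "satisfies_simple_recurrence c (card S)"
  using assms rsquarefree_root_poly[of S] exp_rep_annihilates_dvd[OF assms, of "root_poly S"]
  unfolding satisfies_simple_recurrence_iff exp_rep_def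
  by (intro exI[of _ "root_poly S"]) auto

lemma exp_rep_card_le_degree:
  assumes "exp_rep c S w" "annihilates p c" "p \<noteq> 0"
  shows "card S \<le> degree p"
proof -
  have "finite S"
    using assms(1) by (simp add: exp_rep_def)
  then show ?thesis
    using dvd_imp_degree_le[of "root_poly S" p] exp_rep_annihilates_dvd[OF assms(1), of p] assms(2,3)
    by simp
qed

text \<open>The zero sequence satisfies simple recurrences of every positive order, the least being
  1, but is no combination with a positive number of nonzero weights. The clause that
  \<open>c\<close> is nonzero excludes it.\<close>

proposition moment_rank_iff_recurrence:
  assumes "r \<ge> 1"
  shows "has_moment_rank c r \<longleftrightarrow>
    (\<exists>n. c n \<noteq> 0) \<and> satisfies_simple_recurrence c r \<and>
    (\<forall>s>0. satisfies_simple_recurrence c s \<longrightarrow> r \<le> s)"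
proof
  assume "has_moment_rank c r"
  then obtain S w where S: "exp_rep c S w" "card S = r"
    using assms has_moment_rank_iff by blast
  have "S \<noteq> {}"
    using S(2) assms by auto
  moreover have "r \<le> s" if "satisfies_simple_recurrence c s" for s
    using that exp_rep_card_le_degree[OF S(1)] S(2) unfolding satisfies_simple_recurrence_iff
    by force
  ultimately show "(\<exists>n. c n \<noteq> 0) \<and> satisfies_simple_recurrence c r \<and>
    (\<forall>s>0. satisfies_simple_recurrence c s \<longrightarrow> r \<le> s)"
    using S exp_rep_nonzero exp_rep_simple_recurrence by blast
next
  assume R: "(\<exists>n. c n \<noteq> 0) \<and> satisfies_simple_recurrence c r \<and>
    (\<forall>s>0. satisfies_simple_recurrence c s \<longrightarrow> r \<le> s)"
  then obtain p where p: "degree p = r" "poly p 0 \<noteq> 0" "annihilates p c" "rsquarefree p"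
    using satisfies_simple_recurrence_iff by blast
  obtain S w where S: "exp_rep c S w" "card S \<le> degree p"
    using annihilates_imp_exp_rep[OF p(3,4,2)] .
  \<comment> \<open>Minimality speaks of positive orders only, so \<open>S\<close> has to be
    nonempty before it applies to \<open>card S\<close>.\<close>
  have "S \<noteq> {}" "finite S"
    using S(1) R by (auto simp: exp_rep_def)
  then have "card S > 0"
    by (simp add: card_gt_0_iff)
  then have "card S = r"
    using R[THEN conjunct2, THEN conjunct2, rule_format, OF _ exp_rep_simple_recurrence[OF S(1)]]
      S(2) p(1) by simp
  then show "has_moment_rank c r"
    using assms S(1) has_moment_rank_iff by blast
qed

text \<open>For 1, 0, 0, ... the ideal is generated by x, hence radical and of least degree 1; a
  member that is nonzero at 0 excludes this. In the converse an element of least degree generates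
  the ideal, by division with remainder, and radicality makes it square-free.\<close>

proposition moment_rank_iff_radical_ideal:
  assumes "r \<ge> 1"
  shows "has_moment_rank c r \<longleftrightarrow>
    radical_ideal (recurrence_ideal c) \<and>
    (\<exists>p\<in>recurrence_ideal c. poly p 0 \<noteq> 0) \<and>
    (\<exists>p\<in>recurrence_ideal c. p \<noteq> 0 \<and> degree p = r) \<and>
    (\<forall>p\<in>recurrence_ideal c. p \<noteq> 0 \<longrightarrow> r \<le> degree p)"
proof
  assume "has_moment_rank c r"
  then obtain S w where S: "exp_rep c S w" "card S = r"
    using assms has_moment_rank_iff by blast
  have fin: "finite S" "0 \<notin> S"
    using S by (auto simp: exp_rep_def)
  have "root_poly S \<in> recurrence_ideal c"
    using exp_rep_annihilates_dvd[OF S(1), of "root_poly S"] by (simp add: recurrence_ideal_eq)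
  moreover have "poly (root_poly S) 0 \<noteq> 0" "degree (root_poly S) = r"
    using fin S by auto
  moreover have "radical_ideal (recurrence_ideal c)"
    unfolding radical_ideal_def recurrence_ideal_eq annihilates_exp_rep_iff[OF S(1)]
    by (auto intro!: exI[of _ 1])
  ultimately show "radical_ideal (recurrence_ideal c) \<and>
    (\<exists>p\<in>recurrence_ideal c. poly p 0 \<noteq> 0) \<and>
    (\<exists>p\<in>recurrence_ideal c. p \<noteq> 0 \<and> degree p = r) \<and>
    (\<forall>p\<in>recurrence_ideal c. p \<noteq> 0 \<longrightarrow> r \<le> degree p)"
    using exp_rep_card_le_degree[OF S(1)] S(2) root_poly_nonzero[of S]
    by (auto simp: recurrence_ideal_eq)
next
  assume R: "radical_ideal (recurrence_ideal c) \<and>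
    (\<exists>p\<in>recurrence_ideal c. poly p 0 \<noteq> 0) \<and>
    (\<exists>p\<in>recurrence_ideal c. p \<noteq> 0 \<and> degree p = r) \<and>
    (\<forall>p\<in>recurrence_ideal c. p \<noteq> 0 \<longrightarrow> r \<le> degree p)"
  then obtain p where p: "annihilates p c" "p \<noteq> 0" "degree p = r"
    by (auto simp: recurrence_ideal_eq)
  from R have min: "r \<le> degree q" if "annihilates q c" "q \<noteq> 0" for q
    using that by (auto simp: recurrence_ideal_eq)
  have rad: "annihilates q c" if "annihilates (q ^ 2) c" for q
    using R that unfolding radical_ideal_def recurrence_ideal_eq
    by (metis (mono_tags, lifting) mem_Collect_eq zero_less_numeral)
  have dvd: "p dvd q" if "annihilates q c" for q
  proof (rule ccontr)
    assume "\<not> p dvd q"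
    then have "q mod p \<noteq> 0"
      by (simp add: mod_eq_0_iff_dvd)
    moreover have "annihilates (q mod p) c"
      using annihilates_diff[OF that annihilates_mult[OF p(1), of "q div p"]]
      by (simp add: minus_div_mult_eq_mod)
    ultimately show False
      using min[of "q mod p"] degree_mod_less'[of p q] p by auto
  qed
  have "rsquarefree p"
  proof (rule ccontr)
    assume "\<not> rsquarefree p"
    then obtain z q where q: "p = [:-z, 1:]\<^sup>2 * q"
      using not_has_repeated_root_iff[of p] by (auto simp: has_repeated_root_def elim!: dvdE)
    \<comment> \<open>With p = (x - z)^2 q, the product q p is the square of (x - z) q, which
      radicality puts into the ideal although its degree is r - 1.\<close>
    have "annihilates (q * p) c"
      using p(1) by (rule annihilates_mult)
    then have "annihilates (([:-z, 1:] * q) ^ 2) c"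
      by (simp only: q power2_eq_square mult_ac)
    then have "annihilates ([:-z, 1:] * q) c"
      by (rule rad)
    moreover have "q \<noteq> 0"
      using q p(2) by auto
    ultimately have "r \<le> degree ([:-z, 1:] * q)"
      by (intro min) (auto simp del: mult_pCons_left)
    then show False
      using p(3) \<open>q \<noteq> 0\<close>
      by (simp add: q degree_mult_eq degree_power_eq del: mult_pCons_left)
  qed
  moreover have "poly p 0 \<noteq> 0"
  proof -
    obtain q where "annihilates q c" "poly q 0 \<noteq> 0"
      using R by (auto simp: recurrence_ideal_eq)
    then show ?thesis
      using dvd[of q] by (auto elim!: dvdE)
  qed
  ultimately obtain S w where "exp_rep c S w" "card S = degree p"
    using minimal_annihilates_imp_exp_rep[OF p(1)] min p(3) by blast
  then show "has_moment_rank c r"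
    using assms p(3) has_moment_rank_iff by blast
qed

section \<open>Hankel matrices and the discriminant variety\<close>

definition vec_poly :: "nat \<Rightarrow> complex Matrix.vec \<Rightarrow> complex poly" where
  "vec_poly m v = (\<Sum>j\<le>m. monom (v $ j) j)"

lemma coeff_vec_poly: "coeff (vec_poly m v) j = (if j \<le> m then v $ j else 0)"
  by (simp add: vec_poly_def coeff_sum_monom)

lemma degree_vec_poly_le: "degree (vec_poly m v) \<le> m"
  by (simp add: vec_poly_def degree_sum_monom_le)

lemma vec_poly_eq_0_iff:
  assumes "v \<in> carrier_vec (m + 1)"
  shows "vec_poly m v = 0 \<longleftrightarrow> v = 0\<^sub>v (m + 1)"
  using assms by (auto simp: poly_eq_iff coeff_vec_poly intro!: eq_vecI)

lemma vec_poly_vec_coeff: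
  assumes "degree p \<le> m"
  shows "vec_poly m (Matrix.vec (m + 1) (coeff p)) = p"
  using assms by (auto intro!: poly_eqI simp: coeff_vec_poly coeff_eq_0)

lemma hankel_carrier [simp]: "hankel c m t \<in> carrier_mat (m + 1) (m + 1)"
  by (simp add: hankel_def)

text \<open>Row i pairs the coefficients with the window of \<open>c\<close> that starts at t + i.
  Kernel vectors are thus polynomials that behave like annihilators at m + 1 consecutive
  positions.\<close>

lemma hankel_mult_vec:
  assumes "v \<in> carrier_vec (m + 1)" "i \<le> m"
  shows "(hankel c m t *\<^sub>v v) $ i = poly_action (vec_poly m v) c (t + i)"
  using assms
  by (auto simp: hankel_def poly_action_upto[OF degree_vec_poly_le] coeff_vec_poly scalar_prod_def
      atLeast0LessThan lessThan_Suc_atMost mult_ac add_ac intro!: sum.cong)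

lemma mat_kernel_hankel_iff:
  "v \<in> mat_kernel (hankel c m t) \<longleftrightarrow>
     v \<in> carrier_vec (m + 1) \<and> (\<forall>i\<le>m. poly_action (vec_poly m v) c (t + i) = 0)"
proof -
  have "hankel c m t *\<^sub>v v = 0\<^sub>v (m + 1) \<longleftrightarrow> (\<forall>i\<le>m. (hankel c m t *\<^sub>v v) $ i = 0)"
    by (auto simp: vec_eq_iff hankel_def less_Suc_eq_le)
  then show ?thesis
    unfolding mat_kernel[OF hankel_carrier] using hankel_mult_vec[of v m _ c t] by auto
qed

text \<open>Its contrapositive is the certificate of minimality: if the matrix is nonsingular, no
  nonzero polynomial of degree at most m annihilates \<open>c\<close>.\<close>

lemma det_hankel_eq_0_iff:
  "Determinant.det (hankel c m t) = 0 \<longleftrightarrow>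
     (\<exists>p. p \<noteq> 0 \<and> degree p \<le> m \<and> (\<forall>i\<le>m. poly_action p c (t + i) = 0))"
proof -
  have "Determinant.det (hankel c m t) = 0 \<longleftrightarrow>
      (\<exists>v. v \<in> mat_kernel (hankel c m t) \<and> v \<noteq> 0\<^sub>v (m + 1))"
    unfolding det_0_iff_vec_prod_zero_field[OF hankel_carrier] mat_kernel[OF hankel_carrier] by auto
  also have "\<dots> \<longleftrightarrow> (\<exists>p. p \<noteq> 0 \<and> degree p \<le> m \<and> (\<forall>i\<le>m. poly_action p c (t + i) = 0))"
  proof
    assume "\<exists>v. v \<in> mat_kernel (hankel c m t) \<and> v \<noteq> 0\<^sub>v (m + 1)"
    then show "\<exists>p. p \<noteq> 0 \<and> degree p \<le> m \<and> (\<forall>i\<le>m. poly_action p c (t + i) = 0)"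
      using vec_poly_eq_0_iff degree_vec_poly_le unfolding mat_kernel_hankel_iff by blast
  next
    assume "\<exists>p. p \<noteq> 0 \<and> degree p \<le> m \<and> (\<forall>i\<le>m. poly_action p c (t + i) = 0)"
    then obtain p where p: "p \<noteq> 0" "degree p \<le> m" "\<forall>i\<le>m. poly_action p c (t + i) = 0"
      by blast
    let ?v = "Matrix.vec (m + 1) (coeff p)"
    have "?v \<in> carrier_vec (m + 1)"
      by simp
    then show "\<exists>v. v \<in> mat_kernel (hankel c m t) \<and> v \<noteq> 0\<^sub>v (m + 1)"
      using p vec_poly_vec_coeff[OF p(2)] vec_poly_eq_0_iff[of ?v m]
      unfolding mat_kernel_hankel_iff by metis
  qed
  finally show ?thesis .
qed

lemma exp_rep_det_hankel:
  assumes "exp_rep c S w" "card S = Suc m"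
  shows "Determinant.det (hankel c m t) \<noteq> 0"
proof
  assume "Determinant.det (hankel c m t) = 0"
  then obtain p where p: "p \<noteq> 0" "degree p \<le> m" "\<forall>i\<le>m. poly_action p c (t + i) = 0"
    unfolding det_hankel_eq_0_iff by blast
  have "annihilates p c"
    unfolding annihilates_exp_rep_iff[OF assms(1)]
    using exp_rep_vanish[OF assms(1), of p t] p(3) assms(2) by simp
  then show False
    using exp_rep_card_le_degree[OF assms(1) _ p(1)] p(2) assms(2) by simp
qed

text \<open>The m + 1 rows cover the \<open>card S\<close> consecutive positions that decide
  annihilation, so the starting position t drops out of the kernel.\<close>

lemma mat_kernel_hankel_exp_rep_iff:
  assumes "exp_rep c S w" "card S \<le> m"
  shows "v \<in> mat_kernel (hankel c m t) \<longleftrightarrow> v \<in> carrier_vec (m + 1) \<and> root_poly S dvd vec_poly m v"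
proof -
  have "(\<forall>i\<le>m. poly_action p c (t + i) = 0) \<longleftrightarrow> annihilates p c" for p
    using exp_rep_vanish[OF assms(1), of p t] assms(2) annihilates_exp_rep_iff[OF assms(1), of p]
    by (auto simp: annihilates_def)
  then show ?thesis
    by (simp add: mat_kernel_hankel_iff exp_rep_annihilates_dvd[OF assms(1)])
qed

lemma kernel_dim_hankel_exp_rep:
  assumes "exp_rep c S w"
  shows "kernel_dim (hankel c (card S) t) = 1"
proof -
  let ?r = "card S" and ?H = "hankel c (card S) t"
  let ?v = "Matrix.vec (?r + 1) (coeff (root_poly S))"
  have fin: "finite S"
    using assms by (simp add: exp_rep_def)
  then have deg: "degree (root_poly S) = ?r"
    by simp
  have vp: "vec_poly ?r ?v = root_poly S"
    by (rule vec_poly_vec_coeff) (simp add: deg)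
  have v: "?v \<in> mat_kernel ?H" "?v \<noteq> 0\<^sub>v (?r + 1)"
    using vec_poly_eq_0_iff[of ?v ?r] vp
    by (simp_all add: mat_kernel_hankel_exp_rep_iff[OF assms])
  have multiple: "\<exists>a. u = a \<cdot>\<^sub>v ?v" if "u \<in> mat_kernel ?H" for u
  proof -
    from that have u: "u \<in> carrier_vec (?r + 1)" "root_poly S dvd vec_poly ?r u"
      by (simp_all add: mat_kernel_hankel_exp_rep_iff[OF assms])
    then obtain q where q: "vec_poly ?r u = root_poly S * q"
      by (auto elim: dvdE)
    \<comment> \<open>\<open>root_poly S\<close> already has the full degree that
      \<open>vec_poly\<close> allows, so the cofactor is constant.\<close>
    have "degree q = 0"
    proof (cases "q = 0")
      case False
      then show ?thesis
        using degree_vec_poly_le[of ?r u] by (simp add: q degree_mult_eq deg)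
    qed simp
    then obtain a where "q = [:a:]"
      by (rule degree_eq_zeroE)
    then have "coeff (vec_poly ?r u) j = a * coeff (root_poly S) j" for j
      by (simp add: q)
    then have "u $ j = a * coeff (root_poly S) j" if "j \<le> ?r" for j
      using that by (metis coeff_vec_poly)
    then have "u = a \<cdot>\<^sub>v ?v"
      using u(1) by (intro eq_vecI) auto
    then show ?thesis
      by blast
  qed
  interpret kernel "?r + 1" "?r + 1" ?H
    by (rule kernel.intro) (rule hankel_carrier)
  have "Ker.span {?v} = mat_kernel ?H"
  proof (intro equalityI subsetI)
    fix u assume "u \<in> Ker.span {?v}"
    then show "u \<in> mat_kernel ?H"
      using Ker.span_closed[of "{?v}"] v(1) by blast
  next
    fix u assume "u \<in> mat_kernel ?H"
    then obtain a where a: "u = a \<cdot>\<^sub>v ?v"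
      using multiple by blast
    have "?v \<in> Ker.span {?v}"
      using v(1) by (intro Ker.in_own_span[THEN subsetD]) auto
    then show "u \<in> Ker.span {?v}"
      using submodule.smult_closed[OF Ker.span_is_submodule, of "{?v}" a ?v] v(1)
      by (simp add: a module_vec_simps)
  qed
  then have "Ker.dim = 1"
    using v by (intro Ker.dim1I) auto
  then show ?thesis
    by simp
qed

section \<open>Square-freeness is stable under small changes of the coefficients\<close>

lemma root_norm_bound:
  fixes q :: "nat \<Rightarrow> complex"
  assumes "r > 0" "(\<Sum>i\<le>r. q i * z ^ i) = 0" "1 \<le> norm z"
  shows "norm (q r) * norm z \<le> (\<Sum>i<r. norm (q i))"
proof -
  have "{..r} = insert r {..<r}"
    by auto
  then have "q r * z ^ r = - (\<Sum>i<r. q i * z ^ i)"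
    using assms(2) by (simp add: add_eq_0_iff2)
  then have "norm (q r) * norm z ^ r = norm (\<Sum>i<r. q i * z ^ i)"
    by (metis norm_minus_cancel norm_mult norm_power)
  also have "\<dots> \<le> (\<Sum>i<r. norm (q i * z ^ i))"
    by (rule norm_sum)
  \<comment> \<open>As the norm of z is at least 1, every lower power is dominated by the power r -
    1, which leaves one factor \<open>norm z\<close> on the left.\<close>
  also have "\<dots> \<le> (\<Sum>i<r. norm (q i) * norm z ^ (r - 1))"
  proof (rule sum_mono)
    fix i assume "i \<in> {..<r}"
    then have "norm z ^ i \<le> norm z ^ (r - 1)"
      using assms(3) by (intro power_increasing) auto
    then show "norm (q i * z ^ i) \<le> norm (q i) * norm z ^ (r - 1)"
      by (simp add: norm_mult norm_power mult_left_mono)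
  qed
  also have "\<dots> = (\<Sum>i<r. norm (q i)) * norm z ^ (r - 1)"
    by (simp add: sum_distrib_right)
  finally have "(norm (q r) * norm z) * norm z ^ (r - 1) \<le> (\<Sum>i<r. norm (q i)) * norm z ^ (r - 1)"
    using assms(1) by (cases r) (simp_all add: mult_ac)
  moreover have "norm z ^ (r - 1) > 0"
    using assms(3) by (intro zero_less_power) linarith
  ultimately show ?thesis
    by (simp only: mult_le_cancel_right_pos)
qed

lemma poly_altdef_upto:
  fixes p :: "'a::comm_semiring_1 poly"
  assumes "degree p \<le> n"
  shows "poly p x = (\<Sum>i\<le>n. coeff p i * x ^ i)"
  unfolding poly_altdef using assms
  by (intro sum.mono_neutral_left) (auto simp: coeff_eq_0)

lemma norm_poly_le:
  fixes p :: "complex poly"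
  assumes "degree p \<le> n" "\<And>i. i \<le> n \<Longrightarrow> norm (coeff p i) \<le> e" "norm z \<le> R" "1 \<le> R"
  shows "norm (poly p z) \<le> e * (real (n + 1) * R ^ n)"
proof -
  have "e \<ge> 0"
    using assms(2)[of 0] norm_ge_zero order_trans by blast
  have "poly p z = (\<Sum>i\<le>n. coeff p i * z ^ i)"
    using assms(1) by (rule poly_altdef_upto)
  also have "norm \<dots> \<le> (\<Sum>i\<le>n. norm (coeff p i * z ^ i))"
    by (rule norm_sum)
  also have "\<dots> \<le> (\<Sum>i\<le>n. e * R ^ n)"
  proof (rule sum_mono)
    fix i assume i: "i \<in> {..n}"
    have "norm z ^ i \<le> R ^ i"
      using assms(3) by (intro power_mono) auto
    also have "\<dots> \<le> R ^ n"
      using i assms(4) by (intro power_increasing) auto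
    finally show "norm (coeff p i * z ^ i) \<le> e * R ^ n"
      using assms(2)[of i] i \<open>e \<ge> 0\<close> by (simp add: norm_mult norm_power mult_mono)
  qed
  finally show ?thesis
    by (simp add: mult_ac)
qed

text \<open>All polynomials near \<open>p\<close> have their roots in a common disc, on which \<open>\<bar>p\<bar> + \<bar>p'\<bar>\<close> has a positive
  lower bound; a repeated root of such a polynomial would make that sum small.\<close>

lemma rsquarefree_perturbation:
  fixes p :: "complex poly"
  assumes "rsquarefree p" "degree p = r"
  obtains e where "e > 0"
    and "\<And>q. degree q \<le> r \<Longrightarrow> (\<And>i. i \<le> r \<Longrightarrow> norm (coeff q i - coeff p i) < e) \<Longrightarrow> rsquarefree q"
proof -
  have p0: "p \<noteq> 0"
    using assms(1) by (simp add: rsquarefree_def)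
  define L where "L = norm (coeff p r)"
  have L: "L > 0"
    using p0 assms(2) by (auto simp: L_def)
  \<comment> \<open>\<open>M\<close> bounds the sum of the norms of the lower coefficients of every
    q considered below. With a leading coefficient of norm at least L / 2, the root bound becomes 2
    M / L.\<close>
  define M where "M = (\<Sum>i<r. norm (coeff p i) + L)"
  have "M \<ge> 0"
    unfolding M_def using L by (intro sum_nonneg add_nonneg_nonneg) auto
  define R where "R = 1 + 2 * M / L"
  have R: "R \<ge> 1"
    using L \<open>M \<ge> 0\<close> by (simp add: R_def)
  have "continuous_on (cball 0 R) (\<lambda>z. norm (poly p z) + norm (poly (pderiv p) z))"
    by (intro continuous_intros)
  then have "\<exists>z0\<in>cball 0 R. \<forall>z\<in>cball 0 R.
      norm (poly p z0) + norm (poly (pderiv p) z0) \<le> norm (poly p z) + norm (poly (pderiv p) z)"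
    using R by (intro continuous_attains_inf) auto
  then obtain z0 where z0: "\<And>z. z \<in> cball 0 R \<Longrightarrow>
      norm (poly p z0) + norm (poly (pderiv p) z0) \<le> norm (poly p z) + norm (poly (pderiv p) z)"
    by blast
  define \<delta> where "\<delta> = norm (poly p z0) + norm (poly (pderiv p) z0)"
  have "\<not> (poly p z0 = 0 \<and> poly (pderiv p) z0 = 0)"
    using assms(1) rsquarefree_roots by blast
  then have \<delta>: "\<delta> > 0"
    by (auto simp: \<delta>_def add_nonneg_eq_0_iff less_le)
  define K where "K = real (r + 1) * R ^ r"
  have K: "K > 0"
    using R by (simp add: K_def)
  \<comment> \<open>The first bound keeps the leading coefficient of q at norm at least L / 2. The
    second makes the deviations e K of the value and (r + 1) e K of the derivative add up to at most
    \<open>\<delta> / 2\<close>.\<close>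
  define e where "e = min (L / 2) (\<delta> / (2 * K * (real r + 2)))"
  have e: "e > 0" "e \<le> L / 2" "e * (K * (real r + 2)) \<le> \<delta> / 2"
  proof -
    show "e > 0"
      using L \<delta> K by (simp add: e_def)
    show "e \<le> L / 2"
      unfolding e_def by (rule min.cobounded1)
    have "e \<le> \<delta> / (2 * K * (real r + 2))"
      by (simp add: e_def)
    moreover have "2 * K * (real r + 2) > 0"
      using K by simp
    ultimately have "e * (2 * K * (real r + 2)) \<le> \<delta>"
      by (simp only: pos_le_divide_eq)
    then show "e * (K * (real r + 2)) \<le> \<delta> / 2"
      by (simp add: algebra_simps)
  qed
  have "rsquarefree q" if q: "degree q \<le> r" "\<And>i. i \<le> r \<Longrightarrow> norm (coeff q i - coeff p i) < e" for q
  proof (rule ccontr)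
    assume "\<not> rsquarefree q"
    then obtain z where z: "poly q z = 0" "poly (pderiv q) z = 0"
      using rsquarefree_roots by blast
    have qr: "norm (coeff q r) \<ge> L / 2"
      using q(2)[of r] e(2) norm_triangle_ineq2[of "coeff p r" "coeff q r"]
      by (simp add: L_def norm_minus_commute)
    have "norm z \<le> R"
    proof (cases "r > 0 \<and> norm z \<ge> 1")
      case True
      have "(\<Sum>i\<le>r. coeff q i * z ^ i) = 0"
        using z(1) poly_altdef_upto[OF q(1), of z] by simp
      then have "norm (coeff q r) * norm z \<le> (\<Sum>i<r. norm (coeff q i))"
        using root_norm_bound True by blast
      also have "\<dots> \<le> M"
        unfolding M_def
      proof (rule sum_mono)
        fix i assume "i \<in> {..<r}"
        then show "norm (coeff q i) \<le> norm (coeff p i) + L"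
          using q(2)[of i] e(2) L norm_triangle_ineq2[of "coeff q i" "coeff p i"] by simp
      qed
      finally have "(L / 2) * norm z \<le> M"
        using qr mult_right_mono[OF qr, of "norm z"] by simp
      then show ?thesis
        using L by (simp add: R_def field_simps)
    next
      case False
      have "r \<noteq> 0"
      proof
        assume "r = 0"
        then obtain a where "q = [:a:]"
          using q(1) by (auto elim: degree_eq_zeroE)
        then show False
          using z(1) qr L \<open>r = 0\<close> by simp
      qed
      then show ?thesis
        using False R by simp
    qed
    have "norm (poly (p - q) z) \<le> e * K"
      unfolding K_def
    proof (rule norm_poly_le[OF _ _ \<open>norm z \<le> R\<close> R])
      show "degree (p - q) \<le> r"
        using assms(2) q(1) by (intro degree_diff_le) auto
      show "norm (coeff (p - q) i) \<le> e" if "i \<le> r" for i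
        using q(2)[OF that] by (simp add: norm_minus_commute)
    qed
    moreover have "norm (poly (pderiv (p - q)) z) \<le> ((real r + 1) * e) * K"
      unfolding K_def
    proof (rule norm_poly_le[OF _ _ \<open>norm z \<le> R\<close> R])
      have "degree (p - q) \<le> r"
        using assms(2) q(1) by (intro degree_diff_le) auto
      then show "degree (pderiv (p - q)) \<le> r"
        by (simp add: degree_pderiv)
      fix i assume "i \<le> r"
      show "norm (coeff (pderiv (p - q)) i) \<le> (real r + 1) * e"
      proof (cases "i < r")
        case True
        then have "norm (coeff (p - q) (Suc i)) \<le> e"
          using q(2)[of "Suc i"] by (simp add: norm_minus_commute)
        then show ?thesis
          unfolding coeff_pderiv norm_mult using True e(1)
          by (intro mult_mono) (simp_all flip: of_nat_Suc)
      next
        case False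
        then have "coeff (p - q) (Suc i) = 0"
          using assms(2) q(1) by (simp add: coeff_eq_0)
        then show ?thesis
          using e(1) by (simp only: coeff_pderiv) simp
      qed
    qed
    ultimately have "norm (poly p z) + norm (poly (pderiv p) z) \<le> e * (K * (real r + 2))"
      using z by (simp add: pderiv_diff algebra_simps)
    moreover have "\<delta> \<le> norm (poly p z) + norm (poly (pderiv p) z)"
      using z0[of z] \<open>norm z \<le> R\<close> by (simp add: \<delta>_def)
    ultimately show False
      using e(3) \<delta> by linarith
  qed
  then show ?thesis
    using that e(1) by blast
qed

text \<open>A box of coefficients around \<open>p\<close> is free of polynomials with repeated
  roots. The exact degree matters: (1 - x/n)^2 tends to the square-free constant 1 while its double
  root escapes to infinity.\<close>

lemma rsquarefree_not_in_discriminant_variety: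
  assumes "rsquarefree p" "degree p = r"
  shows "restrict (coeff p) {..r} \<notin> discriminant_variety r"
proof
  let ?b = "restrict (coeff p) {..r}"
  assume b: "?b \<in> discriminant_variety r"
  obtain e where e: "e > 0"
    "\<And>q. degree q \<le> r \<Longrightarrow> (\<And>i. i \<le> r \<Longrightarrow> norm (coeff q i - coeff p i) < e) \<Longrightarrow> rsquarefree q"
    using rsquarefree_perturbation[OF assms] by blast
  let ?U = "\<Pi>\<^sub>E i\<in>{..r}. ball (coeff p i) e"
  have "openin (product_topology (\<lambda>_. euclidean) {..r}) ?U"
    by (simp add: openin_PiE)
  moreover have "?b \<in> ?U"
    using e(1) by auto
  ultimately obtain y where y: "y \<in> ?U" "has_repeated_root (\<Sum>i\<le>r. monom (y i) i)"
    using b unfolding discriminant_variety_def in_closure_of by blast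
  have "rsquarefree (\<Sum>i\<le>r. monom (y i) i)"
    using y(1) by (intro e(2)) (auto simp: degree_sum_monom_le coeff_sum_monom PiE_iff dist_norm norm_minus_commute)
  then show False
    using y(2) not_has_repeated_root_iff by blast
qed

lemma not_in_discriminant_variety_imp_rsquarefree:
  assumes "b \<in> extensional {..r}" "b \<notin> discriminant_variety r"
  shows "rsquarefree (\<Sum>i\<le>r. monom (b i) i)"
proof (rule ccontr)
  let ?A = "{b \<in> {..r} \<rightarrow>\<^sub>E UNIV. has_repeated_root (\<Sum>i\<le>r. monom (b i) i)}"
  assume "\<not> rsquarefree (\<Sum>i\<le>r. monom (b i) i)"
  then have "b \<in> ?A"
    using assms(1) not_has_repeated_root_iff by (auto simp: PiE_def)
  moreover have "?A \<subseteq> discriminant_variety r"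
    unfolding discriminant_variety_def
    by (rule closure_of_subset) (auto simp: topspace_product_topology)
  ultimately show False
    using assms(2) by blast
qed

lemma vec_coords_eq:
  assumes "v \<in> carrier_vec (m + 1)"
  shows "vec_coords v = restrict (coeff (vec_poly m v)) {..m}"
  using assms by (auto simp: vec_coords_def coeff_vec_poly fun_eq_iff)

text \<open>In the converse, a kernel vector off the discriminant variety is the candidate p.
  Equality of the kernels makes it an annihilator, the determinant at t = 0 forces degree r and
  minimality, and the one at t = 1 keeps 0 from being a root.\<close>

proposition moment_rank_iff_hankel:
  assumes "r \<ge> 1"
  shows "has_moment_rank c r \<longleftrightarrow>
    (\<forall>t. Determinant.det (hankel c (r - 1) t) \<noteq> 0) \<and>
    kernel_dim (hankel c r 0) = 1 \<and>
    (\<forall>t. mat_kernel (hankel c r t) = mat_kernel (hankel c r 0)) \<and>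
    \<not> vec_coords ` mat_kernel (hankel c r 0) \<subseteq> discriminant_variety r"
proof
  assume "has_moment_rank c r"
  then obtain S w where S: "exp_rep c S w" "card S = r"
    using has_moment_rank_iff[OF assms] by blast
  then have fin: "finite S"
    by (simp add: exp_rep_def)
  have "Determinant.det (hankel c (r - 1) t) \<noteq> 0" for t
    using exp_rep_det_hankel[OF S(1)] S(2) assms by simp
  moreover have "kernel_dim (hankel c r 0) = 1"
    using kernel_dim_hankel_exp_rep[OF S(1)] S(2) by simp
  moreover have "mat_kernel (hankel c r t) = mat_kernel (hankel c r 0)" for t
    using mat_kernel_hankel_exp_rep_iff[OF S(1)] S(2) by auto
  moreover have "\<not> vec_coords ` mat_kernel (hankel c r 0) \<subseteq> discriminant_variety r"
  proof -
    let ?v = "Matrix.vec (r + 1) (coeff (root_poly S))"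
    have vp: "vec_poly r ?v = root_poly S"
      using vec_poly_vec_coeff[of "root_poly S" r] fin S(2) by simp
    then have "?v \<in> mat_kernel (hankel c r 0)"
      using mat_kernel_hankel_exp_rep_iff[OF S(1), of r ?v] S(2) by simp
    moreover have "vec_coords ?v \<notin> discriminant_variety r"
      using rsquarefree_not_in_discriminant_variety[OF rsquarefree_root_poly[OF fin], of r] fin S(2)
        vec_coords_eq[of ?v r] vp by simp
    ultimately show ?thesis
      by blast
  qed
  ultimately show "(\<forall>t. Determinant.det (hankel c (r - 1) t) \<noteq> 0) \<and>
    kernel_dim (hankel c r 0) = 1 \<and>
    (\<forall>t. mat_kernel (hankel c r t) = mat_kernel (hankel c r 0)) \<and>
    \<not> vec_coords ` mat_kernel (hankel c r 0) \<subseteq> discriminant_variety r"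
    by blast
next
  assume R: "(\<forall>t. Determinant.det (hankel c (r - 1) t) \<noteq> 0) \<and>
    kernel_dim (hankel c r 0) = 1 \<and>
    (\<forall>t. mat_kernel (hankel c r t) = mat_kernel (hankel c r 0)) \<and>
    \<not> vec_coords ` mat_kernel (hankel c r 0) \<subseteq> discriminant_variety r"
  then obtain v where v: "v \<in> mat_kernel (hankel c r 0)" "vec_coords v \<notin> discriminant_variety r"
    by blast
  then have vc: "v \<in> carrier_vec (r + 1)"
    by (simp add: mat_kernel_hankel_iff)
  define p where "p = vec_poly r v"
  have nonsing: "\<not> (\<forall>t. poly_action q c t = 0)" if "q \<noteq> 0" "degree q < r" for q
  proof -
    have "Determinant.det (hankel c (r - 1) 0) \<noteq> 0"
      using R by blast
    moreover have "degree q \<le> r - 1"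
      using that(2) by simp
    ultimately show ?thesis
      using that(1) unfolding det_hankel_eq_0_iff by auto
  qed
  have nonsing1: "\<not> (\<forall>t. poly_action q c (Suc t) = 0)" if "q \<noteq> 0" "degree q < r" for q
  proof -
    have "Determinant.det (hankel c (r - 1) 1) \<noteq> 0"
      using R by blast
    moreover have "degree q \<le> r - 1"
      using that(2) by simp
    ultimately show ?thesis
      using that(1) unfolding det_hankel_eq_0_iff by auto
  qed
  have ann: "annihilates p c"
    unfolding annihilates_def
  proof
    fix t
    have "v \<in> mat_kernel (hankel c r t)"
      using R v(1) by blast
    then show "poly_action p c t = 0"
      unfolding mat_kernel_hankel_iff p_def by (metis add_0_right le0)
  qed
  have "restrict (coeff p) {..r} \<notin> discriminant_variety r"
    using v(2) vec_coords_eq[OF vc] by (simp add: p_def)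
  then have "rsquarefree (\<Sum>i\<le>r. monom (restrict (coeff p) {..r} i) i)"
    by (intro not_in_discriminant_variety_imp_rsquarefree restrict_extensional)
  then have sf: "rsquarefree p"
    using sum_monom_coeff[of p r] degree_vec_poly_le[of r v] by (simp add: p_def)
  then have p0: "p \<noteq> 0"
    by (simp add: rsquarefree_def)
  have deg: "degree p = r"
  proof (rule antisym)
    show "degree p \<le> r"
      by (simp add: p_def degree_vec_poly_le)
    show "r \<le> degree p"
      using nonsing[OF p0] ann not_less unfolding annihilates_def by blast
  qed
  have "poly p 0 \<noteq> 0"
  proof
    assume "poly p 0 = 0"
    \<comment> \<open>With p = x q, the cofactor q of degree r - 1 annihilates the shifted
      sequence.\<close>
    then obtain q where q: "p = pCons 0 q"
      by (metis pCons_cases poly_pCons mult_zero_left add_0_right)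
    have "\<not> (\<forall>t. poly_action q c (Suc t) = 0)"
      using q deg p0 by (intro nonsing1) auto
    then show False
      using ann by (simp add: annihilates_def q poly_action_pCons)
  qed
  then obtain S w where "exp_rep c S w" "card S = degree p"
    using minimal_annihilates_imp_exp_rep[OF ann sf] nonsing deg
    by (metis annihilates_def not_less)
  then show "has_moment_rank c r"
    using has_moment_rank_iff[OF assms] deg by blast
qed

section \<open>Sums of powers of linear forms\<close>

text \<open>The inner \<open>monom\<close> carries x and the outer one y. Each index has its own
  pair of exponents, so coefficients can be read off.\<close>

definition binary_form :: "nat \<Rightarrow> (nat \<Rightarrow> complex) \<Rightarrow> complex poly poly" where
  "binary_form n A = (\<Sum>k\<le>n. monom (monom (A k) (n - k)) k)"

lemma binary_form_eq_iff: "binary_form n A = binary_form n B \<longleftrightarrow> (\<forall>k\<le>n. A k = B k)"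
proof
  assume eq: "binary_form n A = binary_form n B"
  have "coeff (coeff (binary_form n F) k) (n - k) = F k" if "k \<le> n" for F k
    using that by (simp add: binary_form_def coeff_sum_monom)
  then show "\<forall>k\<le>n. A k = B k"
    by (metis eq)
qed (simp add: binary_form_def)

lemma poly_const_monomial:
  "poly_const a * poly_x ^ m * poly_y ^ k = monom (monom a m) k"
proof -
  have x: "poly_x ^ m = [:monom 1 m:]"
    by (induction m) (simp_all add: poly_x_def monom_Suc one_pCons)
  have y: "poly_y = monom 1 1"
    by (simp add: poly_y_def monom_altdef)
  show ?thesis
    by (simp add: x y poly_const_def monom_power smult_monom)
qed

lemma linear_form_power:
  "(poly_const a * poly_x + poly_const b * poly_y) ^ n
    = binary_form n (\<lambda>k. of_nat (n choose k) * a ^ (n - k) * b ^ k)"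
proof -
  have const: "poly_const u ^ m = poly_const (u ^ m)" "of_nat m = poly_const (of_nat m)"
    "poly_const u * poly_const v = poly_const (u * v)" for u v m
    by (simp_all add: poly_const_def poly_const_pow of_nat_poly)
  have "(poly_const b * poly_y + poly_const a * poly_x) ^ n =
      (\<Sum>k\<le>n. of_nat (n choose k) * (poly_const b * poly_y) ^ k * (poly_const a * poly_x) ^ (n - k))"
    by (rule binomial_ring)
  also have "\<dots> = (\<Sum>k\<le>n. poly_const (of_nat (n choose k) * a ^ (n - k) * b ^ k) *
      poly_x ^ (n - k) * poly_y ^ k)"
    by (simp only: power_mult_distrib const(1,2) const(3)[symmetric] mult_ac)
  finally show ?thesis
    by (simp add: poly_const_monomial binary_form_def add.commute)
qed

lemma sum_scaled_binary_forms:
  "(\<Sum>j\<in>J. poly_const (l j) * binary_form n (A j)) = binary_form n (\<lambda>k. \<Sum>j\<in>J. l j * A j k)"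
proof -
  have "poly_const u * monom (monom v m) k = monom (monom (u * v) m) k" for u v m k
    by (simp add: poly_const_def smult_monom)
  then have "(\<Sum>j\<in>J. poly_const (l j) * binary_form n (A j)) =
      (\<Sum>k\<le>n. \<Sum>j\<in>J. monom (monom (l j * A j k) (n - k)) k)"
    unfolding binary_form_def sum_distrib_left by (subst sum.swap) simp
  then show ?thesis
    by (simp add: binary_form_def monom_sum)
qed

text \<open>The binomial coefficient occurs on both sides and is nonzero for k \<le> n, so it
  cancels when coefficients are compared.\<close>

lemma power_sum_forms_iff:
  "(\<Sum>j=0..n. poly_const (of_nat (n choose j) * c (j + t)) * poly_x ^ (n - j) * poly_y ^ j) =
   (\<Sum>j=1..r. poly_const (l j * (\<beta> j / \<alpha> j) ^ t) *
     (poly_const (\<alpha> j) * poly_x + poly_const (\<beta> j) * poly_y) ^ n) \<longleftrightarrow>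
   (\<forall>k\<le>n. c (k + t) = (\<Sum>j=1..r. l j * (\<beta> j / \<alpha> j) ^ t * \<alpha> j ^ (n - k) * \<beta> j ^ k))"
    (is "?L = ?R \<longleftrightarrow> _")
proof -
  have "?L = binary_form n (\<lambda>k. of_nat (n choose k) * c (k + t))"
    by (simp add: poly_const_monomial binary_form_def atLeast0AtMost)
  moreover have "?R = binary_form n (\<lambda>k. \<Sum>j=1..r.
      (l j * (\<beta> j / \<alpha> j) ^ t) * (of_nat (n choose k) * \<alpha> j ^ (n - k) * \<beta> j ^ k))"
    unfolding linear_form_power by (rule sum_scaled_binary_forms)
  moreover have "\<dots> = binary_form n (\<lambda>k. of_nat (n choose k) *
      (\<Sum>j=1..r. l j * (\<beta> j / \<alpha> j) ^ t * \<alpha> j ^ (n - k) * \<beta> j ^ k))"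
    by (simp add: sum_distrib_left mult_ac)
  ultimately show ?thesis
    by (simp add: binary_form_eq_iff)
qed

text \<open>Up to the factor \<open>\<alpha> j ^ (2*r)\<close>, the power of a linear form depends
  only on \<open>\<beta> j / \<alpha> j\<close>, which is the ratio of a geometric sequence.\<close>

proposition moment_rank_iff_forms:
  assumes "r \<ge> 1"
  shows "has_moment_rank c r \<longleftrightarrow>
    (\<exists>\<alpha> \<beta> l :: nat \<Rightarrow> complex.
       (\<forall>j\<in>{1..r}. \<alpha> j \<noteq> 0 \<and> \<beta> j \<noteq> 0 \<and> l j \<noteq> 0) \<and>
       (\<forall>t. (\<Sum>j=0..2*r. poly_const (of_nat ((2*r) choose j) * c (j + t)) *
                 poly_x ^ (2*r - j) * poly_y ^ j) =
            (\<Sum>j=1..r. poly_const (l j * (\<beta> j / \<alpha> j) ^ t) *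
                 (poly_const (\<alpha> j) * poly_x + poly_const (\<beta> j) * poly_y) ^ (2*r))) \<and>
       inj_on (\<lambda>j. \<alpha> j / \<beta> j) {1..r})"
    (is "_ \<longleftrightarrow> ?F")
proof -
  have "has_moment_rank c r \<longleftrightarrow> exponential_sum c r"
    using has_moment_rank_iff[OF assms] exponential_sum_iff by simp
  also have "\<dots> \<longleftrightarrow> ?F"
    unfolding power_sum_forms_iff
  proof
    assume "exponential_sum c r"
    then obtain \<alpha> \<beta> where ab: "\<forall>i\<in>{1..r}. \<alpha> i \<noteq> 0 \<and> \<beta> i \<noteq> 0" "inj_on \<beta> {1..r}"
      "\<And>n. c n = (\<Sum>i=1..r. \<alpha> i * \<beta> i ^ (n + 1))"
      by (auto simp: exponential_sum_def)
    show "\<exists>a b l :: nat \<Rightarrow> complex. (\<forall>j\<in>{1..r}. a j \<noteq> 0 \<and> b j \<noteq> 0 \<and> l j \<noteq> 0) \<and>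
      (\<forall>t. \<forall>k\<le>2*r. c (k + t) = (\<Sum>j=1..r. l j * (b j / a j) ^ t * a j ^ (2*r - k) * b j ^ k)) \<and>
      inj_on (\<lambda>j. a j / b j) {1..r}"
    proof (intro exI conjI allI impI)
      \<comment> \<open>The forms are normalised to \<open>x + \<beta> y\<close>; the weight absorbs
        the extra factor from the exponent n + 1.\<close>
      show "\<forall>j\<in>{1..r}. (1::complex) \<noteq> 0 \<and> \<beta> j \<noteq> 0 \<and> \<alpha> j * \<beta> j \<noteq> 0"
        using ab(1) by simp
      show "c (k + t) = (\<Sum>j=1..r. \<alpha> j * \<beta> j * (\<beta> j / 1) ^ t * 1 ^ (2*r - k) * \<beta> j ^ k)" for t k
        by (simp add: ab(3) power_add mult_ac)
      show "inj_on (\<lambda>j. 1 / \<beta> j) {1..r}"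
      proof (rule inj_onI)
        fix i j assume "i \<in> {1..r}" "j \<in> {1..r}" "1 / \<beta> i = 1 / \<beta> j"
        then show "i = j"
          using inj_onD[OF ab(2), of i j] by (simp only: divide_inverse mult_1 inverse_eq_iff_eq)
      qed
    qed
  next
    assume "\<exists>a b l :: nat \<Rightarrow> complex. (\<forall>j\<in>{1..r}. a j \<noteq> 0 \<and> b j \<noteq> 0 \<and> l j \<noteq> 0) \<and>
      (\<forall>t. \<forall>k\<le>2*r. c (k + t) = (\<Sum>j=1..r. l j * (b j / a j) ^ t * a j ^ (2*r - k) * b j ^ k)) \<and>
      inj_on (\<lambda>j. a j / b j) {1..r}"
    then obtain a b l :: "nat \<Rightarrow> complex" where
      nz: "\<forall>j\<in>{1..r}. a j \<noteq> 0 \<and> b j \<noteq> 0 \<and> l j \<noteq> 0" and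
      eq: "\<And>t k. k \<le> 2*r \<Longrightarrow> c (k + t) = (\<Sum>j=1..r. l j * (b j / a j) ^ t * a j ^ (2*r - k) * b j ^ k)" and
      inj: "inj_on (\<lambda>j. a j / b j) {1..r}"
      by blast
    \<comment> \<open>The coefficients of x^(2r), for all t, already give the whole sequence;
      dividing by the ratio adjusts for the exponent t + 1.\<close>
    have "c t = (\<Sum>j=1..r. (l j * a j ^ (2*r) / (b j / a j)) * (b j / a j) ^ (t + 1))" for t
      using eq[of 0 t] nz by (auto intro!: sum.cong simp: mult_ac)
    moreover have "inj_on (\<lambda>j. b j / a j) {1..r}"
    proof (rule inj_onI)
      fix i j assume "i \<in> {1..r}" "j \<in> {1..r}" "b i / a i = b j / a j"
      then show "i = j"
        using inj_onD[OF inj, of i j] by (metis inverse_divide)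
    qed
    ultimately show "exponential_sum c r"
      unfolding exponential_sum_def using nz
      by (intro exI[of _ "\<lambda>j. l j * a j ^ (2*r) / (b j / a j)"] exI[of _ "\<lambda>j. b j / a j"]) simp
  qed
  finally show ?thesis .
qed

section \<open>The generating function\<close>

lemma poly_has_fps_expansion: "poly (p :: complex poly) has_fps_expansion fps_of_poly p"
proof (induction p)
  case (pCons a p)
  have "(\<lambda>x. a + x * poly p x) has_fps_expansion (fps_const a + fps_X * fps_of_poly p)"
    by (intro fps_expansion_intros pCons.IH)
  moreover have "poly (pCons a p) = (\<lambda>x. a + x * poly p x)"
    by (simp add: fun_eq_iff)
  ultimately show ?case
    by (simp add: fps_of_poly_pCons mult.commute)
qed simp

text \<open>Reversal turns the Cauchy product into the shift action. From index
  \<open>degree p\<close> on all coefficients of p take part; the entries before that will form the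
  numerator.\<close>

lemma fps_nth_reflect_poly_mult:
  "fps_nth (fps_of_poly (reflect_poly p) * Abs_fps c) (degree p + t) = poly_action p c t"
proof -
  let ?d = "degree p"
  have "fps_nth (fps_of_poly (reflect_poly p) * Abs_fps c) (?d + t)
      = (\<Sum>i=0..?d + t. coeff (reflect_poly p) i * c (?d + t - i))"
    by (simp add: fps_mult_nth)
  also have "\<dots> = (\<Sum>i\<le>?d. coeff (reflect_poly p) i * c (?d + t - i))"
    by (rule sum.mono_neutral_right) (auto simp: coeff_reflect_poly)
  also have "\<dots> = (\<Sum>j\<le>?d. coeff p j * c (j + t))"
    by (rule sum.reindex_bij_witness[of _ "\<lambda>j. ?d - j" "\<lambda>i. ?d - i"])
      (auto simp: coeff_reflect_poly)
  finally show ?thesis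
    by (simp add: poly_action_def)
qed

lemma fps_of_poly_numerator:
  fixes F :: "'a::comm_ring_1 fps"
  assumes "\<And>n. n \<ge> r \<Longrightarrow> fps_nth F n = 0"
  obtains P where "fps_of_poly P = F" "P = 0 \<or> degree P < r"
proof
  define P where "P = Abs_poly (\<lambda>n. fps_nth F n)"
  have fin: "\<forall>\<^sub>\<infinity>n. fps_nth F n = 0"
    using assms by (auto simp: MOST_nat_le)
  then have coeff: "coeff P = fps_nth F"
    unfolding P_def by (intro Abs_poly_inverse) simp
  show "fps_of_poly P = F"
    by (rule fps_ext) (simp add: coeff)
  show "P = 0 \<or> degree P < r"
    using assms coeff by (metis leading_coeff_0_iff not_less)
qed

text \<open>Reversal is multiplicative and inverts nonzero roots. As p is nonzero at 0, reversing
  twice gives p back, which carries a double factor of the reversed polynomial over to p.\<close>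

lemma rsquarefree_reflect_poly:
  fixes p :: "complex poly"
  assumes "rsquarefree p" "poly p 0 \<noteq> 0"
  shows "rsquarefree (reflect_poly p)"
proof (rule ccontr)
  assume "\<not> rsquarefree (reflect_poly p)"
  then obtain z where z: "[:-z, 1:]\<^sup>2 dvd reflect_poly p"
    unfolding not_has_repeated_root_iff[symmetric] has_repeated_root_def by blast
  have p0: "p \<noteq> 0" "coeff p 0 \<noteq> 0"
    using assms by (auto simp: poly_0_coeff_0)
  have z0: "z \<noteq> 0"
  proof
    assume "z = 0"
    have "[:-z, 1:] dvd reflect_poly p"
      using z by (metis dvd_mult_left power2_eq_square)
    then have "poly (reflect_poly p) z = 0"
      by (simp add: poly_eq_0_iff_dvd)
    then show False
      using p0 \<open>z = 0\<close> by simp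
  qed
  from z obtain q where "reflect_poly p = [:-z, 1:]\<^sup>2 * q"
    by (rule dvdE)
  then have "p = (reflect_poly [:-z, 1:])\<^sup>2 * reflect_poly q"
    using p0(2) by (metis reflect_poly_mult reflect_poly_power reflect_poly_reflect_poly)
  moreover have "reflect_poly [:-z, 1:] = Polynomial.smult (-z) [:-(1 / z), 1:]"
    using z0 by (simp add: reflect_poly_pCons)
  moreover have "(Polynomial.smult (-z) l)\<^sup>2 * m = l\<^sup>2 * Polynomial.smult (z\<^sup>2) m" for l m
    by (simp add: power2_eq_square)
  ultimately have "p = [:-(1 / z), 1:]\<^sup>2 * (Polynomial.smult (z\<^sup>2) (reflect_poly q))"
    by metis
  then have "[:-(1 / z), 1:]\<^sup>2 dvd p"
    by (rule dvdI)
  then show False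
    using assms(1) not_has_repeated_root_iff has_repeated_root_def by blast
qed

text \<open>Reversing the coefficients exchanges annihilators of \<open>c\<close> and denominators of its generating function.\<close>

definition generating_fraction :: "(nat \<Rightarrow> complex) \<Rightarrow> complex poly \<Rightarrow> complex poly \<Rightarrow> bool" where
  "generating_fraction c P Q \<longleftrightarrow> coprime P Q \<and> poly Q 0 \<noteq> 0 \<and> (P = 0 \<or> degree P < degree Q) \<and>
     fps_of_poly Q * Abs_fps c = fps_of_poly P"

text \<open>As Q is nonzero at 0, reversal preserves its degree, so position t corresponds to the
  coefficient of P at \<open>degree Q + t\<close>, which is zero.\<close>

lemma annihilates_reflect_poly:
  assumes "poly Q 0 \<noteq> 0" "P = 0 \<or> degree P < degree Q" "fps_of_poly Q * Abs_fps c = fps_of_poly P"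
  shows "annihilates (reflect_poly Q) c"
  unfolding annihilates_def
proof
  fix t
  have Q0: "coeff Q 0 \<noteq> 0"
    using assms(1) by (simp add: poly_0_coeff_0)
  have "poly_action (reflect_poly Q) c t = coeff P (degree Q + t)"
    using fps_nth_reflect_poly_mult[of "reflect_poly Q" c t] Q0 assms(3) by simp
  also have "\<dots> = 0"
    using assms(2) by (auto simp: coeff_eq_0)
  finally show "poly_action (reflect_poly Q) c t = 0" .
qed

lemma reflect_poly_numerator:
  assumes "annihilates p c"
  obtains P where "fps_of_poly P = fps_of_poly (reflect_poly p) * Abs_fps c" "P = 0 \<or> degree P < degree p"
proof (rule fps_of_poly_numerator[of "degree p" "fps_of_poly (reflect_poly p) * Abs_fps c"])
  fix n assume "degree p \<le> n"
  then obtain t where "n = degree p + t"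
    by (metis le_Suc_ex)
  then show "fps_nth (fps_of_poly (reflect_poly p) * Abs_fps c) n = 0"
    using assms fps_nth_reflect_poly_mult[of p c t] by (simp add: annihilates_def)
qed (use that in blast)

text \<open>The fraction is in lowest terms because a common factor could be cancelled, and if it
  were not constant, the reversed cofactor of Q would annihilate \<open>c\<close> with degree less
  than \<open>card S\<close>.\<close>

lemma exp_rep_imp_generating_fraction:
  assumes "exp_rep c S w"
  obtains P Q where "generating_fraction c P Q" "rsquarefree Q" "degree Q = card S"
proof -
  have S: "finite S" "0 \<notin> S"
    using assms by (auto simp: exp_rep_def)
  let ?p = "root_poly S"
  define Q where "Q = reflect_poly ?p"
  have p0: "poly ?p 0 \<noteq> 0"
    using S by simp
  then have deg: "degree Q = card S"
    using S(1) by (simp add: Q_def poly_0_coeff_0)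
  have Q0: "poly Q 0 \<noteq> 0"
    by (simp add: Q_def)
  have sf: "rsquarefree Q"
    unfolding Q_def by (intro rsquarefree_reflect_poly rsquarefree_root_poly S(1) p0)
  have "annihilates ?p c"
    by (simp add: exp_rep_annihilates_dvd[OF assms])
  then obtain P where P: "fps_of_poly P = fps_of_poly Q * Abs_fps c" "P = 0 \<or> degree P < card S"
    using reflect_poly_numerator[of ?p c] S(1) unfolding Q_def by auto
  have "coprime P Q"
  proof -
    define g where "g = gcd P Q"
    have "Q \<noteq> 0"
      using Q0 by auto
    then have g: "g \<noteq> 0"
      by (simp add: g_def)
    obtain P1 Q1 where PQ1: "P = g * P1" "Q = g * Q1"
      unfolding g_def by (meson dvdE gcd_dvd1 gcd_dvd2)
    have "Q1 \<noteq> 0"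
      using PQ1(2) \<open>Q \<noteq> 0\<close> by auto
    have "fps_of_poly g * (fps_of_poly Q1 * Abs_fps c) = fps_of_poly g * fps_of_poly P1"
      using P(1) PQ1 by (metis fps_of_poly_mult mult.assoc)
    then have "fps_of_poly Q1 * Abs_fps c = fps_of_poly P1"
      using g by simp
    moreover have Q10: "poly Q1 0 \<noteq> 0"
      using Q0 PQ1(2) by (metis mult_zero_right poly_mult)
    moreover have degQ: "degree Q = degree g + degree Q1"
      using PQ1(2) g \<open>Q1 \<noteq> 0\<close> by (metis degree_mult_eq)
    moreover have "P1 = 0 \<or> degree P1 < degree Q1"
    proof (cases "P1 = 0")
      case False
      then have "degree P = degree g + degree P1" "P \<noteq> 0"
        using PQ1(1) g by (metis degree_mult_eq) (metis PQ1(1) False g mult_eq_0_iff)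
      then show ?thesis
        using P(2) deg degQ by simp
    qed simp
    ultimately have "annihilates (reflect_poly Q1) c"
      using annihilates_reflect_poly by blast
    then have "card S \<le> degree Q1"
      using exp_rep_card_le_degree[OF assms, of "reflect_poly Q1"] \<open>Q1 \<noteq> 0\<close> Q10
      by (simp add: poly_0_coeff_0)
    then have "degree g = 0"
      using degQ deg by simp
    then have "is_unit g"
      using g by (simp add: is_unit_iff_degree)
    then show ?thesis
      unfolding g_def by (simp only: is_unit_gcd)
  qed
  then show ?thesis
    using that[of P Q] P Q0 sf deg by (simp add: generating_fraction_def)
qed

lemma generating_fraction_imp_exp_rep:
  assumes "generating_fraction c P Q" "rsquarefree Q"
  obtains S w where "exp_rep c S w" "card S = degree Q"
proof -
  have PQ: "coprime P Q" "poly Q 0 \<noteq> 0" "P = 0 \<or> degree P < degree Q"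
    "fps_of_poly Q * Abs_fps c = fps_of_poly P"
    using assms(1) by (auto simp: generating_fraction_def)
  let ?p = "reflect_poly Q"
  have Q0: "Q \<noteq> 0"
    using PQ(2) by auto
  have ann: "annihilates ?p c"
    using annihilates_reflect_poly[OF PQ(2-4)] .
  have sf: "rsquarefree ?p"
    using rsquarefree_reflect_poly[OF assms(2) PQ(2)] .
  have p0: "poly ?p 0 \<noteq> 0"
    using Q0 by simp
  have deg: "degree ?p = degree Q"
    using PQ(2) by (simp add: poly_0_coeff_0)
  have min: "degree ?p \<le> degree q" if q: "q \<noteq> 0" "annihilates q c" for q
  proof -
    \<comment> \<open>Any annihilator yields a second fraction for the same series; Q, being coprime
      to P, divides its denominator.\<close>
    obtain A where A: "fps_of_poly A = fps_of_poly (reflect_poly q) * Abs_fps c"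
      using reflect_poly_numerator[OF q(2)] by blast
    have "fps_of_poly (P * reflect_poly q) = fps_of_poly (A * Q)"
      by (simp add: fps_of_poly_mult A PQ(4)[symmetric] mult_ac)
    then have "P * reflect_poly q = A * Q"
      by simp
    then have "Q dvd P * reflect_poly q"
      by simp
    then have "Q dvd reflect_poly q"
      using PQ(1) by (simp add: coprime_commute coprime_dvd_mult_right_iff)
    then have "degree Q \<le> degree (reflect_poly q)"
      using q(1) by (intro dvd_imp_degree_le) auto
    then show ?thesis
      using degree_reflect_poly_le[of q] deg by simp
  qed
  show ?thesis
    using minimal_annihilates_imp_exp_rep[OF ann sf p0 min] that deg by metis
qed

section \<open>Poles and growth at infinity of quotients of polynomials\<close>

lemma eventually_poly_nonzero:
  fixes q :: "complex poly"
  assumes "q \<noteq> 0"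
  shows "eventually (\<lambda>w. poly q w \<noteq> 0) (at z)" and "eventually (\<lambda>w. poly q w \<noteq> 0) at_infinity"
proof -
  have fin: "finite {w. poly q w = 0}"
    using assms by (rule poly_roots_finite)
  show "eventually (\<lambda>w. poly q w \<noteq> 0) (at z)"
    using islimpt_finite[OF fin, of z] by (simp add: islimpt_iff_eventually)
  obtain B where "\<forall>w\<in>{w. poly q w = 0}. norm w \<le> B"
    using finite_imp_bounded[OF fin] by (auto simp: bounded_iff)
  then show "eventually (\<lambda>w. poly q w \<noteq> 0) at_infinity"
    unfolding eventually_at_infinity by (intro exI[of _ "B + 1"]) force
qed

lemma open_poly_nonzero:
  fixes q :: "complex poly"
  assumes "q \<noteq> 0"
  shows "open {w. poly q w \<noteq> 0}"
proof -
  have "open (- {w. poly q w = 0})"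
    by (intro open_Compl finite_imp_closed poly_roots_finite assms)
  then show ?thesis
    by (simp add: Compl_eq)
qed

lemma is_pole_poly_divide_iff:
  fixes P Q :: "complex poly"
  assumes "coprime P Q" "Q \<noteq> 0"
  shows "is_pole (\<lambda>w. poly P w / poly Q w) z \<longleftrightarrow> poly Q z = 0"
proof
  assume pole: "is_pole (\<lambda>w. poly P w / poly Q w) z"
  show "poly Q z = 0"
  proof (rule ccontr)
    assume "poly Q z \<noteq> 0"
    moreover have "open {w. poly Q w \<noteq> 0}"
      by (rule open_poly_nonzero[OF assms(2)])
    moreover have "(\<lambda>w. poly P w / poly Q w) holomorphic_on {w. poly Q w \<noteq> 0}"
      by (intro holomorphic_intros) auto
    ultimately show False
      using pole not_is_pole_holomorphic[of "{w. poly Q w \<noteq> 0}" z] by blast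
  qed
next
  assume z: "poly Q z = 0"
  show "is_pole (\<lambda>w. poly P w / poly Q w) z"
  proof (rule is_pole_divide)
    show "isCont (poly P) z"
      by simp
    show "poly P z \<noteq> 0"
      using coprime_poly_0[OF assms(1), of z] z by blast
    have "isCont (poly Q) z"
      by simp
    then have "(poly Q \<longlongrightarrow> 0) (at z)"
      using z unfolding isCont_def by simp
    then show "filterlim (poly Q) (at 0) (at z)"
      using eventually_poly_nonzero(1)[OF assms(2)] by (simp add: filterlim_at)
  qed
qed

lemma zorder_poly_divide:
  fixes P Q :: "complex poly"
  assumes "coprime P Q" "Q \<noteq> 0" "poly Q z = 0"
  shows "zorder (\<lambda>w. poly P w / poly Q w) z = - int (Polynomial.order z Q)"
proof -
  obtain Q1 where Q1: "Q = [:-z, 1:] ^ Polynomial.order z Q * Q1" "\<not> [:-z, 1:] dvd Q1"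
    using order_decomp[OF assms(2)] by blast
  let ?m = "Polynomial.order z Q"
  have Qw: "poly Q w = (w - z) ^ ?m * poly Q1 w" for w
    by (subst Q1(1)) (simp add: poly_power)
  show ?thesis
  proof (rule zorder_eqI)
    show "open {w. poly Q1 w \<noteq> 0}"
      using Q1(2) by (intro open_poly_nonzero) auto
    show "z \<in> {w. poly Q1 w \<noteq> 0}"
      using Q1(2) by (simp add: poly_eq_0_iff_dvd)
    show "(\<lambda>w. poly P w / poly Q1 w) holomorphic_on {w. poly Q1 w \<noteq> 0}"
      by (intro holomorphic_intros) auto
    show "poly P z / poly Q1 z \<noteq> 0"
      using Q1(2) coprime_poly_0[OF assms(1), of z] assms(3) by (simp add: poly_eq_0_iff_dvd)
    show "poly P w / poly Q w = poly P w / poly Q1 w * (w - z) powi - int ?m" if "w \<noteq> z" for w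
      using that by (simp add: Qw power_int_minus field_simps)
  qed
qed

text \<open>In lowest terms the poles and their orders are the roots of Q and their multiplicities;
  if all are simple, their number is the degree.\<close>

lemma exactly_simple_poles_poly_divide_iff:
  fixes P Q :: "complex poly"
  assumes "coprime P Q" "Q \<noteq> 0"
  shows "exactly_simple_poles (\<lambda>w. poly P w / poly Q w) r \<longleftrightarrow> rsquarefree Q \<and> degree Q = r"
proof -
  have "rsquarefree Q \<longleftrightarrow> (\<forall>z. poly Q z = 0 \<longrightarrow> zorder (\<lambda>w. poly P w / poly Q w) z = -1)"
  proof -
    have "rsquarefree Q \<longleftrightarrow> (\<forall>z. poly Q z = 0 \<longrightarrow> Polynomial.order z Q = 1)"
      using assms(2) order_root[of Q] unfolding rsquarefree_def by metis
    then show ?thesis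
      using zorder_poly_divide[OF assms] by simp
  qed
  moreover have "finite {z. poly Q z = 0}"
    using assms(2) by (rule poly_roots_finite)
  ultimately show ?thesis
    using rsquarefree_card_roots[of Q]
    unfolding exactly_simple_poles_def is_pole_poly_divide_iff[OF assms] by auto
qed

text \<open>For z nonzero the quotient is the reversed polynomial at 1/z, whose value at 0 is the
  leading coefficient.\<close>

lemma poly_asymptotic_at_infinity:
  fixes p :: "complex poly"
  shows "((\<lambda>z. poly p z / z ^ degree p) \<longlongrightarrow> lead_coeff p) at_infinity"
proof -
  have "isCont (poly (reflect_poly p)) 0"
    by simp
  then have "((\<lambda>z. poly (reflect_poly p) (inverse z)) \<longlongrightarrow> poly (reflect_poly p) 0) at_infinity"
    using tendsto_inverse_0 by (rule isCont_tendsto_compose)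
  moreover have "eventually (\<lambda>z. poly (reflect_poly p) (inverse z) = poly p z / z ^ degree p) at_infinity"
  proof (rule eventually_at_infinityI[of 1])
    fix z :: complex assume "1 \<le> norm z"
    then have "inverse z \<noteq> 0"
      by auto
    then show "poly (reflect_poly p) (inverse z) = poly p z / z ^ degree p"
      using poly_reflect_poly_nz[of "inverse z" p] by (simp add: divide_inverse power_inverse)
  qed
  ultimately show ?thesis
    by (simp add: tendsto_cong)
qed

lemma poly_divide_tendsto_0_iff:
  fixes P Q :: "complex poly"
  assumes "Q \<noteq> 0"
  shows "((\<lambda>z. poly P z / poly Q z) \<longlongrightarrow> 0) at_infinity \<longleftrightarrow> P = 0 \<or> degree P < degree Q"
proof
  have ne: "eventually (\<lambda>z. poly Q z \<noteq> 0 \<and> z \<noteq> 0) at_infinity"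
    using eventually_poly_nonzero(2)[OF assms] eventually_not_equal_at_infinity[of 0]
    by eventually_elim auto
  \<comment> \<open>The limit is kept as \<open>0 ^ k\<close>: it is 1 for k = 0, which the first
    implication has to allow, and 0 for k > 0, which the second one needs.\<close>
  have inv: "((\<lambda>z::complex. inverse z ^ k) \<longlongrightarrow> 0 ^ k) at_infinity" for k
    by (intro tendsto_power tendsto_inverse_0)
  show "P = 0 \<or> degree P < degree Q" if lim: "((\<lambda>z. poly P z / poly Q z) \<longlongrightarrow> 0) at_infinity"
  proof (rule ccontr)
    assume "\<not> (P = 0 \<or> degree P < degree Q)"
    then obtain k where k: "degree P = degree Q + k" "P \<noteq> 0"
      using le_Suc_ex not_less by metis
    have "((\<lambda>z. poly P z / poly Q z * (poly Q z / z ^ degree Q) * inverse z ^ k) \<longlongrightarrow>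
        0 * lead_coeff Q * 0 ^ k) at_infinity"
      by (intro tendsto_mult lim poly_asymptotic_at_infinity inv)
    moreover have "eventually (\<lambda>z. poly P z / poly Q z * (poly Q z / z ^ degree Q) * inverse z ^ k
        = poly P z / z ^ degree P) at_infinity"
      using ne by eventually_elim (simp add: k(1) power_add field_simps)
    ultimately have "((\<lambda>z. poly P z / z ^ degree P) \<longlongrightarrow> 0) at_infinity"
      by (simp add: tendsto_cong)
    then have "lead_coeff P = 0"
      using poly_asymptotic_at_infinity[of P] by (intro tendsto_unique[OF trivial_limit_at_infinity])
    then show False
      using k(2) by simp
  qed
  show "((\<lambda>z. poly P z / poly Q z) \<longlongrightarrow> 0) at_infinity" if "P = 0 \<or> degree P < degree Q"
    using that
  proof
    assume "degree P < degree Q"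
    then obtain k where k: "degree Q = degree P + k" "k > 0"
      using less_imp_add_positive by metis
    have "((\<lambda>z. (poly P z / z ^ degree P) / (poly Q z / z ^ degree Q) * inverse z ^ k) \<longlongrightarrow>
        lead_coeff P / lead_coeff Q * 0 ^ k) at_infinity"
      using assms by (intro tendsto_mult tendsto_divide poly_asymptotic_at_infinity inv) auto
    moreover have "eventually (\<lambda>z. (poly P z / z ^ degree P) / (poly Q z / z ^ degree Q) * inverse z ^ k
        = poly P z / poly Q z) at_infinity"
      using ne by eventually_elim (simp add: k(1) power_add field_simps)
    ultimately have "((\<lambda>z. poly P z / poly Q z) \<longlongrightarrow> lead_coeff P / lead_coeff Q * 0 ^ k) at_infinity"
      by (rule Lim_transform_eventually)
    then show ?thesis
      using k(2) by (simp add: zero_power)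
  qed simp
qed

text \<open>Poles and their orders ignore the value at the point itself. This permits cancelling
  common factors even though a quotient takes the default value 0 wherever its denominator
  vanishes.\<close>

lemma exactly_simple_poles_cong:
  assumes "\<And>z. eventually (\<lambda>w. f w = g w) (at z)"
  shows "exactly_simple_poles f r \<longleftrightarrow> exactly_simple_poles g r"
proof -
  have "is_pole f z \<longleftrightarrow> is_pole g z" "zorder f z = zorder g z" for z
    using assms[of z] by (auto intro!: is_pole_cong zorder_cong)
  then show ?thesis
    by (simp add: exactly_simple_poles_def)
qed

text \<open>Q may vanish at 0, where division returns 0, so the product with Q is known to equal P
  only off 0. Having an expansion makes that product continuous at 0, which settles the remaining
  value.\<close>

lemma has_fps_expansion_poly_divide_imp:
  fixes P Q :: "complex poly"
  assumes "(\<lambda>z. poly P z / poly Q z) has_fps_expansion F" "Q \<noteq> 0"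
  shows "fps_of_poly Q * F = fps_of_poly P"
proof -
  let ?f = "\<lambda>z. poly Q z * (poly P z / poly Q z)"
  have f: "?f has_fps_expansion fps_of_poly Q * F"
    by (rule has_fps_expansion_mult[OF poly_has_fps_expansion assms(1)])
  have ev: "eventually (\<lambda>z. ?f z = poly P z) (at 0)"
    using eventually_poly_nonzero(1)[OF assms(2)] by eventually_elim simp
  have "(?f \<longlongrightarrow> ?f 0) (at 0)"
    using has_fps_expansion_imp_continuous[OF f, of UNIV] by (simp add: continuous_within)
  then have "(poly P \<longlongrightarrow> ?f 0) (at 0)"
    using ev by (rule Lim_transform_eventually)
  moreover have "(poly P \<longlongrightarrow> poly P 0) (at 0)"
    using isCont_def poly_isCont by blast
  ultimately have "?f 0 = poly P 0"
    using tendsto_unique[OF at_neq_bot] by blast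
  then have "eventually (\<lambda>z. ?f z = poly P z) (nhds 0)"
    using ev by (auto simp: eventually_nhds_conv_at)
  then have "poly P has_fps_expansion fps_of_poly Q * F"
    using has_fps_expansion_cong[of ?f "poly P" _ "fps_of_poly Q * F", OF _ refl] f by simp
  then show ?thesis
    using poly_has_fps_expansion fps_expansion_unique_complex by blast
qed

text \<open>Vanishing at infinity removes the polynomial part: 1 + 1/(1 - z) has a single simple
  pole, but its coefficients 2, 1, 1, ... do not have moment rank 1.\<close>

proposition moment_rank_iff_generating_function:
  assumes "r \<ge> 1"
  shows "has_moment_rank c r \<longleftrightarrow>
    (\<exists>\<Phi>. \<Phi> has_fps_expansion Abs_fps c \<and> rational_function \<Phi> \<and>
       (\<Phi> \<longlongrightarrow> 0) at_infinity \<and> exactly_simple_poles \<Phi> r)"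
proof
  assume "has_moment_rank c r"
  then obtain S w where S: "exp_rep c S w" "card S = r"
    using has_moment_rank_iff[OF assms] by blast
  obtain P Q where PQ: "generating_fraction c P Q" "rsquarefree Q" "degree Q = r"
    using exp_rep_imp_generating_fraction[OF S(1)] S(2) by metis
  let ?\<Phi> = "\<lambda>z. poly P z / poly Q z"
  have Q: "coprime P Q" "poly Q 0 \<noteq> 0" "P = 0 \<or> degree P < degree Q"
    "fps_of_poly Q * Abs_fps c = fps_of_poly P" "Q \<noteq> 0"
    using PQ(1) by (auto simp: generating_fraction_def)
  have "fps_nth (fps_of_poly Q) 0 \<noteq> 0"
    using Q(2) by (simp add: poly_0_coeff_0)
  then have "?\<Phi> has_fps_expansion fps_of_poly P / fps_of_poly Q"
    by (intro has_fps_expansion_divide' poly_has_fps_expansion)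
  moreover have "fps_of_poly P / fps_of_poly Q = Abs_fps c"
    using Q(5) unfolding Q(4)[symmetric] by (subst nonzero_mult_div_cancel_left) simp_all
  ultimately have "?\<Phi> has_fps_expansion Abs_fps c"
    by simp
  moreover have "rational_function ?\<Phi>"
    using Q(5) by (auto simp: rational_function_def)
  moreover have "(?\<Phi> \<longlongrightarrow> 0) at_infinity"
    using Q(3,5) by (simp add: poly_divide_tendsto_0_iff)
  moreover have "exactly_simple_poles ?\<Phi> r"
    using PQ(2,3) Q(1,5) by (simp add: exactly_simple_poles_poly_divide_iff)
  ultimately show "\<exists>\<Phi>. \<Phi> has_fps_expansion Abs_fps c \<and> rational_function \<Phi> \<and>
       (\<Phi> \<longlongrightarrow> 0) at_infinity \<and> exactly_simple_poles \<Phi> r"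
    by blast
next
  assume "\<exists>\<Phi>. \<Phi> has_fps_expansion Abs_fps c \<and> rational_function \<Phi> \<and>
       (\<Phi> \<longlongrightarrow> 0) at_infinity \<and> exactly_simple_poles \<Phi> r"
  then obtain P0 Q0 where Q0: "Q0 \<noteq> 0" and
    \<Phi>: "(\<lambda>z. poly P0 z / poly Q0 z) has_fps_expansion Abs_fps c"
      "((\<lambda>z. poly P0 z / poly Q0 z) \<longlongrightarrow> 0) at_infinity"
      "exactly_simple_poles (\<lambda>z. poly P0 z / poly Q0 z) r"
    by (auto simp: rational_function_def)
  have "gcd P0 Q0 \<noteq> 0"
    using Q0 by simp
  then obtain P Q where PQ: "P0 = P * gcd P0 Q0" "Q0 = Q * gcd P0 Q0" "coprime P Q"
    using gcd_coprime_exists[of P0 Q0] by blast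
  define g where "g = gcd P0 Q0"
  have g: "g \<noteq> 0" "P0 = P * g" "Q0 = Q * g" "Q \<noteq> 0"
    using PQ Q0 by (auto simp: g_def)
  have cancel: "poly P0 w / poly Q0 w = poly P w / poly Q w" if "poly Q0 w \<noteq> 0" for w
    using that by (simp add: g(2,3))
  have "exactly_simple_poles (\<lambda>z. poly P z / poly Q z) r"
    using \<Phi>(3) eventually_mono[OF eventually_poly_nonzero(1)[OF Q0] cancel]
    by (subst (asm) exactly_simple_poles_cong) auto
  then have Q: "rsquarefree Q" "degree Q = r"
    using PQ(3) g(4) by (simp_all add: exactly_simple_poles_poly_divide_iff)
  have "((\<lambda>z. poly P z / poly Q z) \<longlongrightarrow> 0) at_infinity"
    using \<Phi>(2) eventually_mono[OF eventually_poly_nonzero(2)[OF Q0] cancel]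
    by (rule Lim_transform_eventually)
  then have degP: "P = 0 \<or> degree P < degree Q"
    using g(4) by (simp add: poly_divide_tendsto_0_iff)
  have "fps_of_poly Q0 * Abs_fps c = fps_of_poly P0"
    using has_fps_expansion_poly_divide_imp[OF \<Phi>(1) Q0] .
  then have "fps_of_poly g * (fps_of_poly Q * Abs_fps c) = fps_of_poly g * fps_of_poly P"
    by (simp add: g(2,3) fps_of_poly_mult mult_ac)
  then have eq: "fps_of_poly Q * Abs_fps c = fps_of_poly P"
    using g(1) by simp
  \<comment> \<open>A power series has no pole at 0: comparing constant terms would give P a root
    there as well, against coprimality.\<close>
  have "poly Q 0 \<noteq> 0"
  proof
    assume "poly Q 0 = 0"
    then have "poly P 0 = 0"
      using arg_cong[OF eq, of "\<lambda>F. fps_nth F 0"] by (simp add: poly_0_coeff_0)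
    then show False
      using \<open>poly Q 0 = 0\<close> coprime_poly_0[OF PQ(3), of 0] by blast
  qed
  then have "generating_fraction c P Q"
    using PQ(3) degP eq by (simp add: generating_fraction_def)
  then obtain S w where "exp_rep c S w" "card S = degree Q"
    using generating_fraction_imp_exp_rep[OF _ Q(1)] by blast
  then show "has_moment_rank c r"
    using has_moment_rank_iff[OF assms] Q(2) by blast
qed

section \<open>The infinite Hankel matrix\<close>

lemma sum_fun_apply: "(\<Sum>x\<in>A. f x) n = (\<Sum>x\<in>A. f x n)"
  by (induction A rule: infinite_finite_induct) simp_all

lemma independent_geometric:
  assumes "finite S"
  shows "complex_seq.independent ((\<lambda>\<beta> n. \<beta> ^ n) ` S)" and "inj_on (\<lambda>\<beta> n. \<beta> ^ n :: complex) S"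
proof -
  let ?g = "\<lambda>\<beta> n. \<beta> ^ n :: complex"
  show inj: "inj_on ?g S"
    by (rule inj_onI) (metis power_one_right)
  show "complex_seq.independent (?g ` S)"
    unfolding complex_seq.dependent_finite[OF finite_imageI[OF assms]]
  proof safe
    fix u b
    assume sum: "(\<Sum>v\<in>?g ` S. (\<lambda>n. u v * v n)) = 0" and b: "b \<in> S" and u: "u (?g b) \<noteq> 0"
    have "(\<Sum>\<beta>\<in>S. u (?g \<beta>) * \<beta> ^ n) = 0" for n
      using fun_cong[OF sum, of n] by (simp add: sum.reindex[OF inj] sum_fun_apply)
    then show False
      using power_sums_zero[OF assms _ b, of "\<lambda>\<beta>. u (?g \<beta>)"] u by simp
  qed
qed

text \<open>The columns are the shifts of \<open>c\<close>, and they span the same space as the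
  geometric sequences. To reach the sequence of b, a polynomial vanishing on the rest of
  \<open>S\<close> is applied to \<open>c\<close>; its action is a combination of columns and
  isolates b.\<close>

lemma exp_rep_has_rank_inf:
  assumes "exp_rep c S w"
  shows "has_rank_inf (hankel_inf c) (card S)"
proof -
  let ?g = "\<lambda>\<beta> n. \<beta> ^ n :: complex"
  let ?C = "range (\<lambda>j i. hankel_inf c i j)"
  have S: "finite S" "0 \<notin> S" "\<forall>\<beta>\<in>S. w \<beta> \<noteq> 0" and c: "\<And>n. c n = (\<Sum>\<beta>\<in>S. w \<beta> * \<beta> ^ n)"
    using assms by (auto simp: exp_rep_def)
  have sub1: "?C \<subseteq> complex_seq.span (?g ` S)"
  proof
    fix f assume "f \<in> ?C"
    then obtain j where "f = (\<lambda>i. c (i + j))"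
      by (auto simp: hankel_inf_def)
    then have "f = (\<Sum>\<beta>\<in>S. (\<lambda>i. (w \<beta> * \<beta> ^ j) * ?g \<beta> i))"
      by (auto simp: c fun_eq_iff sum_fun_apply power_add mult_ac)
    moreover have "\<dots> \<in> complex_seq.span (?g ` S)"
      by (rule complex_seq.span_sum, rule complex_seq.span_scale, rule complex_seq.span_base) simp
    ultimately show "f \<in> complex_seq.span (?g ` S)"
      by simp
  qed
  have sub2: "?g ` S \<subseteq> complex_seq.span ?C"
  proof safe
    fix b assume b: "b \<in> S"
    define p where "p = root_poly (S - {b})"
    define K where "K = w b * poly p b"
    have K: "K \<noteq> 0"
      using S b by (simp add: K_def p_def)
    have "poly_action p c i = K * b ^ i" for i
      unfolding exp_rep_action[OF assms] K_def using S(1) b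
      by (subst sum.remove[of _ b]) (auto simp: p_def intro!: sum.neutral)
    then have "?g b = (\<lambda>i. (1 / K) * poly_action p c i)"
      using K by simp
    moreover have "poly_action p c = (\<Sum>j\<le>degree p. (\<lambda>i. coeff p j * hankel_inf c i j))"
      by (simp add: poly_action_def fun_eq_iff sum_fun_apply hankel_inf_def add.commute)
    moreover have "\<dots> \<in> complex_seq.span ?C"
      by (rule complex_seq.span_sum, rule complex_seq.span_scale, rule complex_seq.span_base) simp
    ultimately show "?g b \<in> complex_seq.span ?C"
      using complex_seq.span_scale[of "poly_action p c" ?C "1 / K"] by simp
  qed
  have "complex_seq.span (?g ` S) = complex_seq.span ?C"
    using sub1 sub2 by (simp add: complex_seq.span_eq)
  then have "complex_seq.dim ?C = card (?g ` S)"
    using independent_geometric(1)[OF S(1)] by (rule complex_seq.dim_eq_card)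
  moreover have "finite (?g ` S)"
    using S(1) by simp
  ultimately show ?thesis
    unfolding has_rank_inf_def using sub1 independent_geometric(2)[OF S(1)]
    by (auto simp: card_image intro!: exI[of _ "?g ` S"])
qed

lemma exp_rep_vandermonde_decomposition:
  assumes "exp_rep c S w"
  shows "nondegenerate_vandermonde_decomposition (hankel_inf c)"
proof -
  have S: "finite S" "0 \<notin> S" and c: "\<And>n. c n = (\<Sum>\<beta>\<in>S. w \<beta> * \<beta> ^ n)"
    using assms by (auto simp: exp_rep_def)
  obtain a where a: "bij_betw a {..<card S} S"
    using S(1) by (metis atLeast0LessThan ex_bij_betw_nat_finite)
  define D where "D = Matrix.mat (card S) (card S) (\<lambda>(k, l). if k = l then w (a k) else 0)"
  have "a k \<noteq> 0" if "k < card S" for k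
    using a S that by (auto simp: bij_betw_def)
  then have "\<forall>k<card S. \<forall>j. vandermonde a k j \<noteq> 0"
    by (simp add: vandermonde_def)
  moreover have "hankel_inf c i j =
    (\<Sum>k<card S. \<Sum>l<card S. vandermonde a k i * D $$ (k, l) * vandermonde a l j)" for i j
  proof -
    have "(\<Sum>l<card S. vandermonde a k i * D $$ (k, l) * vandermonde a l j) = w (a k) * a k ^ (i + j)"
      if "k < card S" for k
      using that
      by (subst sum.remove[of _ k]) (auto simp: D_def vandermonde_def power_add intro!: sum.neutral)
    then show ?thesis
      by (simp add: hankel_inf_def c sum.reindex_bij_betw[OF a, symmetric])
  qed
  ultimately show ?thesis
    unfolding nondegenerate_vandermonde_decomposition_def
    by (intro exI[of _ "card S"] exI[of _ a] exI[of _ D]) (auto simp: D_def diagonal_mat_def)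
qed

text \<open>Nodes may coincide and diagonal entries may vanish or cancel, so the entries are summed
  over equal nodes before zero weights are dropped.\<close>

lemma vandermonde_decomposition_imp_exp_rep:
  assumes "nondegenerate_vandermonde_decomposition (hankel_inf c)"
  shows "\<exists>S w. exp_rep c S w"
proof -
  obtain s a D where D: "D \<in> carrier_mat s s" "diagonal_mat D"
    "\<forall>k<s. \<forall>j. vandermonde a k j \<noteq> 0"
    "\<And>i j. hankel_inf c i j = (\<Sum>k<s. \<Sum>l<s. vandermonde a k i * D $$ (k, l) * vandermonde a l j)"
    using assms by (auto simp: nondegenerate_vandermonde_decomposition_def)
  \<comment> \<open>At index 1 the Vandermonde entry is the node itself; index 0 always gives
    1.\<close>
  have a0: "a k \<noteq> 0" if "k < s" for k
    using D(3)[rule_format, OF that, of 1] by (simp add: vandermonde_def)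
  define w where "w \<beta> = (\<Sum>k\<in>{k. k < s \<and> a k = \<beta>}. D $$ (k, k))" for \<beta>
  have "c n = (\<Sum>\<beta>\<in>a ` {..<s}. w \<beta> * \<beta> ^ n)" for n
  proof -
    have "c n = (\<Sum>k<s. \<Sum>l<s. vandermonde a k n * D $$ (k, l) * vandermonde a l 0)"
      using D(4)[of n 0] by (simp add: hankel_inf_def)
    also have "\<dots> = (\<Sum>k<s. D $$ (k, k) * a k ^ n)"
    proof (rule sum.cong[OF refl])
      fix k assume "k \<in> {..<s}"
      moreover have "D $$ (k, l) = 0" if "l < s" "l \<noteq> k" "k < s" for l
        using that D(1,2) by (auto simp: diagonal_mat_def)
      ultimately show "(\<Sum>l<s. vandermonde a k n * D $$ (k, l) * vandermonde a l 0)
          = D $$ (k, k) * a k ^ n"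
        by (subst sum.remove[of _ k]) (auto simp: vandermonde_def intro!: sum.neutral)
    qed
    also have "\<dots> = (\<Sum>\<beta>\<in>a ` {..<s}. \<Sum>k\<in>{k. k \<in> {..<s} \<and> a k = \<beta>}. D $$ (k, k) * a k ^ n)"
      by (rule sum.image_gen) simp
    also have "\<dots> = (\<Sum>\<beta>\<in>a ` {..<s}. w \<beta> * \<beta> ^ n)"
      by (auto simp: w_def sum_distrib_right intro!: sum.cong)
    finally show ?thesis .
  qed
  then have "exp_rep c {\<beta>\<in>a ` {..<s}. w \<beta> \<noteq> 0} w"
    using a0 by (intro exp_rep_drop_zero; auto)
  then show ?thesis
    by blast
qed

proposition moment_rank_iff_rank_vandermonde:
  assumes "r \<ge> 1"
  shows "has_moment_rank c r \<longleftrightarrow>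
    has_rank_inf (hankel_inf c) r \<and> nondegenerate_vandermonde_decomposition (hankel_inf c)"
proof
  assume "has_moment_rank c r"
  then obtain S w where "exp_rep c S w" "card S = r"
    using has_moment_rank_iff[OF assms] by blast
  then show "has_rank_inf (hankel_inf c) r \<and> nondegenerate_vandermonde_decomposition (hankel_inf c)"
    using exp_rep_has_rank_inf[of c S w] exp_rep_vandermonde_decomposition[of c S w] by simp
next
  assume R: "has_rank_inf (hankel_inf c) r \<and> nondegenerate_vandermonde_decomposition (hankel_inf c)"
  then obtain S w where S: "exp_rep c S w"
    using vandermonde_decomposition_imp_exp_rep by blast
  then have "card S = r"
    using exp_rep_has_rank_inf[OF S] R by (simp add: has_rank_inf_def)
  then show "has_moment_rank c r"
    using assms S has_moment_rank_iff by blast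
qed

section \<open>Atomic measures\<close>

text \<open>A point measure lives on the power set of \<open>S\<close>; pushing it forward along the
  identity makes it a Borel measure.\<close>

definition atoms :: "complex set \<Rightarrow> (complex \<Rightarrow> real) \<Rightarrow> complex measure" where
  "atoms S u = distr (point_measure S u) borel (\<lambda>x. x)"

lemma sets_atoms [simp]: "sets (atoms S u) = sets borel"
  by (simp add: atoms_def)

lemma
  fixes f :: "complex \<Rightarrow> complex"
  assumes "finite S" "\<And>x. x \<in> S \<Longrightarrow> 0 \<le> u x"
  shows finite_measure_atoms: "finite_measure (atoms S u)"
    and measure_atoms: "B \<in> sets borel \<Longrightarrow> measure (atoms S u) B = (\<Sum>x\<in>S \<inter> B. u x)"
    and integrable_atoms: "f \<in> borel_measurable borel \<Longrightarrow> integrable (atoms S u) f"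
    and integral_atoms: "f \<in> borel_measurable borel \<Longrightarrow> integral\<^sup>L (atoms S u) f = (\<Sum>x\<in>S. u x *\<^sub>R f x)"
proof -
  have id: "(\<lambda>x. x) \<in> measurable (point_measure S u) borel"
    by simp
  have "emeasure (point_measure S u) (space (point_measure S u)) \<noteq> \<infinity>"
    using assms(1) by (simp add: space_point_measure emeasure_point_measure_finite)
  then show "finite_measure (atoms S u)"
    unfolding atoms_def by (intro finite_measure.finite_measure_distr finite_measureI id)
  show "measure (atoms S u) B = (\<Sum>x\<in>S \<inter> B. u x)" if "B \<in> sets borel"
    unfolding atoms_def using measure_distr[OF id that] assms
    by (simp add: space_point_measure measure_point_measure_finite_if Int_commute)
  show "integrable (atoms S u) f" if "f \<in> borel_measurable borel"
    unfolding atoms_def using assms(1) integrable_distr_eq[OF id that]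
    by (simp add: integrable_point_measure_finite)
  show "integral\<^sup>L (atoms S u) f = (\<Sum>x\<in>S. u x *\<^sub>R f x)" if "f \<in> borel_measurable borel"
    unfolding atoms_def using assms integral_distr[OF id that]
    by (simp add: lebesgue_integral_point_measure_finite)
qed

text \<open>For k = 0, 1, 2, 3 these are the positive parts of Re z, Im z, -Re z and -Im z, one for
  each of the four measures in the definition of the integral.\<close>

definition quarter_part :: "nat \<Rightarrow> complex \<Rightarrow> real" where
  "quarter_part k z = max 0 (Re (z * (- \<i>) ^ k))"

lemma sum_lessThan_4:
  fixes f :: "nat \<Rightarrow> 'a::comm_monoid_add"
  shows "(\<Sum>k<4. f k) = f 0 + f 1 + f 2 + f 3"
  by (simp add: eval_nat_numeral)

lemma quarter_part_sum: "(\<Sum>k<4. \<i> ^ k * complex_of_real (quarter_part k z)) = z"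
  by (simp add: sum_lessThan_4 quarter_part_def complex_eq_iff power3_eq_cube max_def)

text \<open>In a disjoint family each point contributes to at most one term of the series.\<close>

lemma complex_measure_atomic_sum:
  assumes "finite S"
  shows "complex_measure M (\<lambda>B. \<Sum>x\<in>S \<inter> B. w x)"
  unfolding complex_measure_def
proof (intro allI impI)
  fix A :: "nat \<Rightarrow> 'a set"
  assume A: "range A \<subseteq> sets M \<and> disjoint_family A"
  have restrict: "(\<Sum>x\<in>S \<inter> B. w x) = (\<Sum>x\<in>S. if x \<in> B then w x else 0)" for B
    using assms by (rule sum.inter_restrict)
  have "(\<lambda>n. if x \<in> A n then w x else 0) sums (if x \<in> (\<Union>n. A n) then w x else 0)" for x
  proof (cases "x \<in> (\<Union>n. A n)")
    case True
    then obtain m where "x \<in> A m"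
      by blast
    then have "x \<in> A n \<longleftrightarrow> n = m" for n
      using A by (auto simp: disjoint_family_on_def)
    then show ?thesis
      using True sums_single[of m "\<lambda>_. w x"] by simp
  qed simp
  then show "(\<lambda>n. \<Sum>x\<in>S \<inter> A n. w x) sums (\<Sum>x\<in>S \<inter> (\<Union>n. A n). w x)"
    unfolding restrict by (intro sums_sum)
qed

lemma has_complex_integral_atomic_sum:
  fixes f :: "complex \<Rightarrow> complex"
  assumes "finite S" "f \<in> borel_measurable borel"
  shows "has_complex_integral borel (\<lambda>B. \<Sum>x\<in>S \<inter> B. w x) f (\<Sum>x\<in>S. w x * f x)"
  unfolding has_complex_integral_def
proof (intro exI conjI allI impI ballI)
  let ?\<nu> = "\<lambda>k. atoms S (\<lambda>x. quarter_part k (w x))"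
  have nonneg: "0 \<le> quarter_part k z" for k z
    by (simp add: quarter_part_def)
  fix k :: nat
  show "sets (?\<nu> k) = sets borel" "finite_measure (?\<nu> k)" "integrable (?\<nu> k) f"
    using assms nonneg by (auto intro!: finite_measure_atoms integrable_atoms)
  show "(\<Sum>x\<in>S \<inter> B. w x) = (\<Sum>k<4. \<i> ^ k * complex_of_real (measure (?\<nu> k) B))"
    if "B \<in> sets borel" for B
  proof -
    have "(\<Sum>k<4. \<i> ^ k * complex_of_real (measure (?\<nu> k) B))
        = (\<Sum>k<4. \<Sum>x\<in>S \<inter> B. \<i> ^ k * complex_of_real (quarter_part k (w x)))"
      using assms(1) nonneg that by (simp add: measure_atoms sum_distrib_left)
    also have "\<dots> = (\<Sum>x\<in>S \<inter> B. \<Sum>k<4. \<i> ^ k * complex_of_real (quarter_part k (w x)))"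
      by (rule sum.swap)
    finally show ?thesis
      by (simp only: quarter_part_sum)
  qed
  show "(\<Sum>x\<in>S. w x * f x) = (\<Sum>k<4. \<i> ^ k * (\<integral>x. f x \<partial>?\<nu> k))"
  proof -
    have "(\<Sum>k<4. \<i> ^ k * (\<integral>x. f x \<partial>?\<nu> k))
        = (\<Sum>k<4. \<Sum>x\<in>S. \<i> ^ k * complex_of_real (quarter_part k (w x)) * f x)"
      using assms nonneg
      by (simp add: integral_atoms sum_distrib_left scaleR_conv_of_real mult.assoc)
    also have "\<dots> = (\<Sum>x\<in>S. (\<Sum>k<4. \<i> ^ k * complex_of_real (quarter_part k (w x))) * f x)"
      by (subst sum.swap) (simp only: sum_distrib_right)
    finally show ?thesis
      by (simp only: quarter_part_sum)
  qed
qed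

text \<open>The part off \<open>A\<close> is written as an integral against a restricted measure,
  given by a density, so that it can be compared through an equality of measures.\<close>

lemma integral_split_finite:
  fixes f :: "complex \<Rightarrow> complex"
  assumes "sets M = sets borel" "finite_measure M" "integrable M f" "finite A"
  shows "integral\<^sup>L M f = integral\<^sup>L (density M (\<lambda>x. ennreal (indicator (- A) x))) f
    + (\<Sum>a\<in>A. measure M {a} *\<^sub>R f a)"
proof -
  interpret finite_measure M
    by fact
  have space: "space M = UNIV"
    using sets_eq_imp_space_eq[OF assms(1)] by simp
  have meas [measurable]: "- A \<in> sets M" "{a} \<in> sets M" for a
    using assms(4) by (simp_all add: assms(1) borel_open open_Compl finite_imp_closed)
  have [measurable]: "f \<in> borel_measurable M"
    using assms(3) by simp
  have split: "f x = indicator (- A) x *\<^sub>R f x + (\<Sum>a\<in>A. indicator {a} x *\<^sub>R f a)" for x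
  proof (cases "x \<in> A")
    case True
    then have "(\<Sum>a\<in>A. indicator {a} x *\<^sub>R f a) = (\<Sum>a\<in>A. if a = x then f x else 0)"
      by (intro sum.cong) (auto simp: indicator_def)
    then show ?thesis
      using True assms(4) by simp
  qed (auto simp: indicator_def intro!: sum.neutral)
  have int1: "integrable M (\<lambda>x. indicator (- A) x *\<^sub>R f x)"
    using integrable_mult_indicator[OF meas(1) assms(3)] .
  have ind: "integrable M (indicator {a} :: complex \<Rightarrow> real)" for a
    by (intro integrable_real_indicator meas(2)) (simp add: emeasure_eq_measure)
  then have int2: "integrable M (\<lambda>x. indicator {a} x *\<^sub>R f a)" for a
    by (intro integrable_scaleR_left)
  have "integral\<^sup>L M f = (\<integral>x. indicator (- A) x *\<^sub>R f x + (\<Sum>a\<in>A. indicator {a} x *\<^sub>R f a) \<partial>M)"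
    using split by (intro Bochner_Integration.integral_cong) auto
  also have "\<dots> = (\<integral>x. indicator (- A) x *\<^sub>R f x \<partial>M) + (\<Sum>a\<in>A. \<integral>x. indicator {a} x *\<^sub>R f a \<partial>M)"
    using int1 int2 by (simp add: Bochner_Integration.integral_add Bochner_Integration.integral_sum)
  also have "(\<integral>x. indicator (- A) x *\<^sub>R f x \<partial>M) = integral\<^sup>L (density M (\<lambda>x. ennreal (indicator (- A) x))) f"
    by (subst integral_density) auto
  also have "(\<Sum>a\<in>A. \<integral>x. indicator {a} x *\<^sub>R f a \<partial>M) = (\<Sum>a\<in>A. measure M {a} *\<^sub>R f a)"
    by (intro sum.cong refl) (subst integral_scaleR_left, rule ind, simp add: space)
  finally show ?thesis .
qed

text \<open>The restrictions to the complement of \<open>A\<close> coincide as measures, so whatever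
  mass lies there cancels.\<close>

lemma integral_diff_agree_off_finite:
  fixes f :: "complex \<Rightarrow> complex"
  assumes M: "sets M = sets borel" "finite_measure M" "integrable M f"
    and N: "sets N = sets borel" "finite_measure N" "integrable N f"
    and A: "finite A"
    and agree: "\<And>B. B \<in> sets borel \<Longrightarrow> B \<subseteq> - A \<Longrightarrow> measure M B = measure N B"
  shows "integral\<^sup>L M f - integral\<^sup>L N f = (\<Sum>a\<in>A. complex_of_real (measure M {a} - measure N {a}) * f a)"
proof -
  have A_borel: "- A \<in> sets borel"
    using A by (intro borel_open open_Compl finite_imp_closed)
  have emeasure_off: "emeasure (density L (\<lambda>x. ennreal (indicator (- A) x))) B = ennreal (measure L (- A \<inter> B))"
    if "sets L = sets borel" "finite_measure L" "B \<in> sets borel" for L and B :: "complex set"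
  proof -
    interpret finite_measure L
      by fact
    have "emeasure (density L (\<lambda>x. ennreal (indicator (- A) x))) B
        = (\<integral>\<^sup>+x. ennreal (indicator (- A) x) * indicator B x \<partial>L)"
      using that(1,3) A_borel by (intro emeasure_density) auto
    also have "\<dots> = (\<integral>\<^sup>+x. indicator (- A \<inter> B) x \<partial>L)"
      by (intro nn_integral_cong) (auto simp: indicator_def)
    also have "\<dots> = emeasure L (- A \<inter> B)"
      using that(1,3) A_borel by (intro nn_integral_indicator) auto
    finally show ?thesis
      by (simp add: emeasure_eq_measure)
  qed
  have "density M (\<lambda>x. ennreal (indicator (- A) x)) = density N (\<lambda>x. ennreal (indicator (- A) x))"
  proof (rule measure_eqI)
    fix B assume "B \<in> sets (density M (\<lambda>x. ennreal (indicator (- A) x)))"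
    then have B: "B \<in> sets borel"
      by (simp add: M(1))
    then have "measure M (- A \<inter> B) = measure N (- A \<inter> B)"
      using A_borel by (intro agree) auto
    then show "emeasure (density M (\<lambda>x. ennreal (indicator (- A) x))) B
        = emeasure (density N (\<lambda>x. ennreal (indicator (- A) x))) B"
      using emeasure_off[OF M(1,2) B] emeasure_off[OF N(1,2) B] by simp
  qed (simp add: M(1) N(1))
  then show ?thesis
    using integral_split_finite[OF M A] integral_split_finite[OF N A]
    by (simp add: scaleR_conv_of_real sum_subtractf algebra_simps)
qed

text \<open>The positive measures decomposing an atomic \<open>\<mu>\<close> may have mass off \<open>A\<close>, but there \<open>\<nu> 0 = \<nu> 2\<close> and
  \<open>\<nu> 1 = \<nu> 3\<close>, so these contributions cancel.\<close>

lemma has_complex_integral_atomic: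
  fixes f :: "complex \<Rightarrow> complex"
  assumes "has_complex_integral borel \<mu> f I" "finite A"
    and "\<And>B. B \<in> sets borel \<Longrightarrow> B \<subseteq> - A \<Longrightarrow> \<mu> B = 0"
  shows "I = (\<Sum>x\<in>A. \<mu> {x} * f x)"
proof -
  obtain \<nu> :: "nat \<Rightarrow> complex measure" where
    \<nu>: "\<And>k. k < 4 \<Longrightarrow> sets (\<nu> k) = sets borel" "\<And>k. k < 4 \<Longrightarrow> finite_measure (\<nu> k)"
      "\<And>k. k < 4 \<Longrightarrow> integrable (\<nu> k) f"
    and \<mu>: "\<And>B. B \<in> sets borel \<Longrightarrow> \<mu> B = (\<Sum>k<4. \<i> ^ k * complex_of_real (measure (\<nu> k) B))"
    and I: "I = (\<Sum>k<4. \<i> ^ k * (\<integral>x. f x \<partial>\<nu> k))"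
    using assms(1) unfolding has_complex_integral_def by blast
  have \<mu>_eq: "\<mu> B = complex_of_real (measure (\<nu> 0) B - measure (\<nu> 2) B)
      + \<i> * complex_of_real (measure (\<nu> 1) B - measure (\<nu> 3) B)" if "B \<in> sets borel" for B
    using \<mu>[OF that] by (simp add: sum_lessThan_4 power3_eq_cube algebra_simps)
  \<comment> \<open>Both differences are real, so \<open>\<mu> B = 0\<close> splits into its real
    and imaginary parts.\<close>
  have agree: "measure (\<nu> 0) B = measure (\<nu> 2) B \<and> measure (\<nu> 1) B = measure (\<nu> 3) B"
    if "B \<in> sets borel" "B \<subseteq> - A" for B
    using assms(3)[OF that] \<mu>_eq[OF that(1)] by (simp add: complex_eq_iff)
  have 02: "integral\<^sup>L (\<nu> 0) f - integral\<^sup>L (\<nu> 2) f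
      = (\<Sum>a\<in>A. complex_of_real (measure (\<nu> 0) {a} - measure (\<nu> 2) {a}) * f a)"
    using agree by (intro integral_diff_agree_off_finite \<nu> assms(2)) auto
  have 13: "integral\<^sup>L (\<nu> 1) f - integral\<^sup>L (\<nu> 3) f
      = (\<Sum>a\<in>A. complex_of_real (measure (\<nu> 1) {a} - measure (\<nu> 3) {a}) * f a)"
    using agree by (intro integral_diff_agree_off_finite \<nu> assms(2)) auto
  have "I = (integral\<^sup>L (\<nu> 0) f - integral\<^sup>L (\<nu> 2) f) + \<i> * (integral\<^sup>L (\<nu> 1) f - integral\<^sup>L (\<nu> 3) f)"
    unfolding I by (simp add: sum_lessThan_4 power3_eq_cube algebra_simps)
  also have "\<dots> = (\<Sum>x\<in>A. \<mu> {x} * f x)"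
    unfolding 02 13 sum_distrib_left sum.distrib[symmetric]
  proof (rule sum.cong[OF refl])
    fix a assume "a \<in> A"
    have "{a} \<in> sets borel"
      by simp
    then show "complex_of_real (measure (\<nu> 0) {a} - measure (\<nu> 2) {a}) * f a
        + \<i> * (complex_of_real (measure (\<nu> 1) {a} - measure (\<nu> 3) {a}) * f a) = \<mu> {a} * f a"
      by (simp only: \<mu>_eq distrib_right mult.assoc)
  qed
  finally show ?thesis .
qed

text \<open>An atom at 0 contributes to the moment of order 0 only, as 0^0 = 1, and no geometric
  sequence with nonzero ratio does that; hence the clause about \<open>{0}\<close>.\<close>

proposition moment_rank_iff_atomic_measure:
  assumes "r \<ge> 1"
  shows "has_moment_rank c r \<longleftrightarrow>
    (\<exists>\<mu>. complex_measure borel \<mu> \<and> atomic_measure borel \<mu> r \<and> \<mu> {0} = 0 \<and>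
         moment_sequence_of \<mu> c)"
proof
  assume "has_moment_rank c r"
  then obtain S w where S: "exp_rep c S w" "card S = r"
    using has_moment_rank_iff[OF assms] by blast
  then have fin: "finite S" "0 \<notin> S" and w: "\<And>x. x \<in> S \<Longrightarrow> w x \<noteq> 0"
    and c: "\<And>n. c n = (\<Sum>\<beta>\<in>S. w \<beta> * \<beta> ^ n)"
    by (auto simp: exp_rep_def)
  let ?\<mu> = "\<lambda>B. \<Sum>x\<in>S \<inter> B. w x"
  have "complex_measure borel ?\<mu>"
    using fin(1) by (rule complex_measure_atomic_sum)
  moreover have "atomic_measure borel ?\<mu> r"
    unfolding atomic_measure_def
  proof (intro exI[of _ S] conjI ballI impI)
    show "?\<mu> {x} \<noteq> 0" if "x \<in> S" for x
      using that w by simp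
    show "?\<mu> B = 0" if "B \<subseteq> space borel - S" for B
      using that by (intro sum.neutral) auto
  qed (use fin S in auto)
  moreover have "?\<mu> {0} = 0"
    using fin(2) by simp
  moreover have "moment_sequence_of ?\<mu> c"
    unfolding moment_sequence_of_def c using fin(1)
    by (intro allI has_complex_integral_atomic_sum) auto
  ultimately show "\<exists>\<mu>. complex_measure borel \<mu> \<and> atomic_measure borel \<mu> r \<and> \<mu> {0} = 0 \<and>
      moment_sequence_of \<mu> c"
    by blast
next
  assume "\<exists>\<mu>. complex_measure borel \<mu> \<and> atomic_measure borel \<mu> r \<and> \<mu> {0} = 0 \<and>
      moment_sequence_of \<mu> c"
  then obtain \<mu> A where \<mu>: "\<mu> {0} = 0" "moment_sequence_of \<mu> c"
    and A: "finite A" "card A = r" "\<forall>x\<in>A. \<mu> {x} \<noteq> 0"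
      "\<forall>B\<in>sets borel. B \<subseteq> space borel - A \<longrightarrow> \<mu> B = 0"
    unfolding atomic_measure_def by blast
  have "c n = (\<Sum>x\<in>A. \<mu> {x} * x ^ n)" for n
    using \<mu>(2) A(1,4) unfolding moment_sequence_of_def
    by (intro has_complex_integral_atomic) (auto simp: Compl_eq_Diff_UNIV)
  moreover have "0 \<notin> A"
    using \<mu>(1) A(3) by auto
  ultimately have "exp_rep c A (\<lambda>x. \<mu> {x})"
    using A(1,3) by (simp add: exp_rep_def)
  then show "has_moment_rank c r"
    using has_moment_rank_iff[OF assms] A(2) by blast
qed

section \<open>The algorithm MRANK\<close>

lemma mrank_mat_eq_hankel: "mrank_mat c (Suc m) = hankel c m 0"
  by (rule eq_matI) (auto simp: mrank_mat_def mrank_vec_def hankel_def mat_of_cols_index add.commute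
      simp del: upt_Suc)

lemma coeff_mrank_poly: "coeff (mrank_poly c r) n = (if n \<le> r then mrank_coeff c r n else 0)"
  by (simp add: mrank_poly_def coeff_sum_monom)

lemma mrank_poly_monic: "degree (mrank_poly c r) = r" "lead_coeff (mrank_poly c r) = 1"
proof -
  have "coeff (mrank_poly c r) r = 1"
    by (simp add: coeff_mrank_poly mrank_coeff_def)
  then show "degree (mrank_poly c r) = r"
    by (intro antisym le_degree) (simp_all add: mrank_poly_def degree_sum_monom_le)
  with \<open>coeff (mrank_poly c r) r = 1\<close> show "lead_coeff (mrank_poly c r) = 1"
    by simp
qed

lemma satisfies_recurrence_mrank_coeff_iff:
  "satisfies_recurrence c r (mrank_coeff c r) \<longleftrightarrow> annihilates (mrank_poly c r) c"
  by (simp add: satisfies_recurrence_iff mrank_poly_def)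

lemma mat_inverse_exists:
  fixes A :: "'a::field mat"
  assumes "A \<in> carrier_mat n n" "Determinant.det A \<noteq> 0"
  obtains B where "mat_inverse A = Some B" "B \<in> carrier_mat n n" "A * B = 1\<^sub>m n" "B * A = 1\<^sub>m n"
proof (cases "mat_inverse A")
  case None
  then have "A \<notin> Units (ring_mat TYPE('a) n ())"
    using mat_inverse(1)[OF assms(1), where b = "()"] by blast
  then show ?thesis
    using det_non_zero_imp_unit[OF assms, where b = "()"] by blast
next
  case (Some B)
  then show ?thesis
    using mat_inverse(2)[OF assms(1) Some] that by blast
qed

text \<open>The rows of the linear system solved by the algorithm say that the monic polynomial acts
  as zero at the first m + 1 positions; the right-hand side is the contribution of its leading
  term.\<close>

lemma mrank_poly_action:
  assumes "Determinant.det (mrank_mat c (Suc m)) \<noteq> 0" "i \<le> m"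
  shows "poly_action (mrank_poly c (Suc m)) c i = 0"
proof -
  let ?C = "mrank_mat c (Suc m)" and ?d = "mrank_vec c (Suc m) (Suc m)"
  have C: "?C \<in> carrier_mat (Suc m) (Suc m)"
    using hankel_carrier[of c m 0] by (simp add: mrank_mat_eq_hankel)
  obtain B where B: "mat_inverse ?C = Some B" "B \<in> carrier_mat (Suc m) (Suc m)" "?C * B = 1\<^sub>m (Suc m)"
    using mat_inverse_exists[OF C assms(1)] by blast
  have d: "?d \<in> carrier_vec (Suc m)"
    by (simp add: mrank_vec_def)
  define a where "a = - (B *\<^sub>v ?d)"
  have a: "a \<in> carrier_vec (Suc m)"
    using B(2) d by (simp add: a_def)
  have "?C *\<^sub>v (B *\<^sub>v ?d) = ?d"
    using assoc_mult_mat_vec[OF C B(2) d] B(3) d by simp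
  moreover have "?C *\<^sub>v a = - (?C *\<^sub>v (B *\<^sub>v ?d))"
    unfolding a_def using C B(2) d by (intro eq_vecI) auto
  ultimately have "(?C *\<^sub>v a) $ i = - c (Suc m + i)"
    using assms(2) by (simp add: mrank_vec_def)
  then have "poly_action (vec_poly m a) c i = - c (Suc m + i)"
    using hankel_mult_vec[of a m i c 0] a assms(2) by (simp add: mrank_mat_eq_hankel)
  moreover have "mrank_poly c (Suc m) = vec_poly m a + monom 1 (Suc m)"
    by (rule poly_eqI)
      (auto simp: coeff_mrank_poly coeff_vec_poly mrank_coeff_def B(1) a_def)
  moreover have "poly_action (monom 1 (Suc m)) c i = c (Suc m + i)"
    by (simp add: poly_action_upto[of _ "Suc m"] degree_monom_eq)
  ultimately show ?thesis
    by (simp add: poly_action_add)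
qed

text \<open>The difference of two monic solutions has degree at most m and lies in the kernel of a
  nonsingular Hankel matrix.\<close>

lemma mrank_poly_unique:
  assumes "Determinant.det (mrank_mat c (Suc m)) \<noteq> 0" "degree q = Suc m" "lead_coeff q = 1"
    and "\<And>i. i \<le> m \<Longrightarrow> poly_action q c i = 0"
  shows "mrank_poly c (Suc m) = q"
proof (rule ccontr)
  assume "mrank_poly c (Suc m) \<noteq> q"
  define p where "p = mrank_poly c (Suc m) + Polynomial.smult (-1) q"
  have "p \<noteq> 0"
    using \<open>mrank_poly c (Suc m) \<noteq> q\<close> by (simp add: p_def)
  moreover have "degree p \<le> m"
  proof (rule degree_le, intro allI impI)
    fix j assume "m < j"
    then have "j = Suc m \<or> j > Suc m"
      by auto
    then show "coeff p j = 0"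
      using mrank_poly_monic[of c "Suc m"] assms(2,3) by (auto simp: p_def coeff_eq_0)
  qed
  moreover have "poly_action p c (0 + i) = 0" if "i \<le> m" for i
    unfolding p_def poly_action_add poly_action_smult
    using mrank_poly_action[OF assms(1) that] assms(4)[OF that] by simp
  ultimately have "Determinant.det (hankel c m 0) = 0"
    unfolding det_hankel_eq_0_iff by blast
  then show False
    using assms(1) by (simp add: mrank_mat_eq_hankel)
qed

lemma exp_rep_mrank_loop_returned:
  assumes "exp_rep c S w" "card S = Suc m"
  shows "\<exists>\<alpha>. mrank_loop c (Suc m) (Returned (Suc m) \<alpha>)"
proof -
  have fin: "finite S" "0 \<notin> S"
    using assms(1) by (auto simp: exp_rep_def)
  have det: "Determinant.det (mrank_mat c (Suc m)) \<noteq> 0"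
    using exp_rep_det_hankel[OF assms] by (simp add: mrank_mat_eq_hankel)
  have ann: "annihilates (root_poly S) c"
    by (simp add: exp_rep_annihilates_dvd[OF assms(1)])
  have eq: "mrank_poly c (Suc m) = root_poly S"
    using ann fin(1) assms(2) lead_coeff_root_poly[of S]
    by (intro mrank_poly_unique[OF det]) (simp_all add: annihilates_def del: lead_coeff_root_poly)
  obtain \<beta> where \<beta>: "set \<beta> = S" "distinct \<beta>"
    using finite_distinct_list[OF fin(1)] by blast
  have len: "length \<beta> = Suc m"
    using \<beta> assms(2) distinct_card by metis
  define M where "M = Matrix.mat (Suc m) (Suc m) (\<lambda>(i, j). \<beta> ! i ^ (j + 1))"
  have M: "M \<in> carrier_mat (Suc m) (Suc m)"
    by (simp add: M_def)
  \<comment> \<open>A kernel vector would be a nonzero polynomial of degree at most m with m + 1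
    roots; exponents starting at 1 only cost a factor z, nonzero on \<open>S\<close>.\<close>
  have "Determinant.det M \<noteq> 0"
  proof
    assume "Determinant.det M = 0"
    then obtain v where v: "v \<in> carrier_vec (Suc m)" "v \<noteq> 0\<^sub>v (Suc m)" "M *\<^sub>v v = 0\<^sub>v (Suc m)"
      using det_0_iff_vec_prod_zero_field[OF M] by blast
    have "poly (vec_poly m v) z = 0" if "z \<in> S" for z
    proof -
      from that obtain i where i: "i < Suc m" "\<beta> ! i = z"
        using \<beta>(1) len by (metis in_set_conv_nth)
      have "(M *\<^sub>v v) $ i = (\<Sum>j\<le>m. z ^ (j + 1) * v $ j)"
        using i v(1) by (simp add: M_def scalar_prod_def atLeast0LessThan lessThan_Suc_atMost)
      also have "\<dots> = z * poly (vec_poly m v) z"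
        by (simp add: vec_poly_def poly_sum poly_monom sum_distrib_left mult_ac)
      finally show ?thesis
        using v(3) i(1) that fin(2) by auto
    qed
    then have "root_poly S dvd vec_poly m v"
      by (intro root_poly_dvd fin(1))
    moreover have "vec_poly m v \<noteq> 0"
      using v(1,2) vec_poly_eq_0_iff[of v m] by simp
    ultimately have "card S \<le> m"
      using dvd_imp_degree_le[of "root_poly S" "vec_poly m v"] fin(1) degree_vec_poly_le[of m v]
      by simp
    then show False
      using assms(2) by simp
  qed
  then obtain W where W: "mat_inverse M = Some W"
    using mat_inverse_exists[OF M] by blast
  have "mrank_loop c (Suc m) (Returned (Suc m) (transpose_mat W *\<^sub>v mrank_vec c (Suc m) 0))"
  proof (rule mrank_loop.returned[OF det])
    show "satisfies_recurrence c (Suc m) (mrank_coeff c (Suc m))"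
      using ann eq by (simp add: satisfies_recurrence_mrank_coeff_iff)
    show "\<not> has_repeated_root (mrank_poly c (Suc m))"
      using eq rsquarefree_root_poly[OF fin(1)] not_has_repeated_root_iff by simp
    show "distinct \<beta>" "set \<beta> = {z. poly (mrank_poly c (Suc m)) z = 0}"
      using \<beta> eq fin(1) by auto
    show "mat_inverse (Matrix.mat (Suc m) (Suc m) (\<lambda>(i, j). \<beta> ! i ^ (j + 1))) = Some W"
      using W by (simp only: M_def)
  qed
  then show ?thesis
    by blast
qed

text \<open>Downward induction on the counter. Below \<open>card S\<close> the monic
  \<open>mrank_poly\<close> has too small a degree to annihilate \<open>c\<close>, so the loop
  continues whether or not the determinant vanishes.\<close>

lemma exp_rep_mrank:
  assumes "exp_rep c S w" "1 \<le> s" "s \<le> card S" "mrank_loop c (card S) res"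
  shows "mrank_loop c s res"
  using assms(3,2)
proof (induction s rule: inc_induct)
  case base
  then show ?case
    using assms(4) by simp
next
  case (step s)
  then have IH: "mrank_loop c (s + 1) res"
    by simp
  have "mrank_poly c s \<noteq> 0"
    using mrank_poly_monic(2)[of c s] by auto
  then have "\<not> satisfies_recurrence c s (mrank_coeff c s)"
    using exp_rep_card_le_degree[OF assms(1), of "mrank_poly c s"] step.hyps mrank_poly_monic(1)[of c s]
    by (auto simp: satisfies_recurrence_mrank_coeff_iff)
  then show ?case
    using IH mrank_loop.singular mrank_loop.no_recurrence by blast
qed

text \<open>Rules that continue the loop leave the result unchanged, so a returned result stems from
  tests passed at its own counter value.\<close>

lemma mrank_loop_returned:
  assumes "mrank_loop c s res" "res = Returned r \<alpha>"
  shows "Determinant.det (mrank_mat c r) \<noteq> 0 \<and> satisfies_recurrence c r (mrank_coeff c r) \<and>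
     \<not> has_repeated_root (mrank_poly c r) \<and>
     (\<exists>\<beta> W. distinct \<beta> \<and> set \<beta> = {z. poly (mrank_poly c r) z = 0} \<and>
       mat_inverse (Matrix.mat r r (\<lambda>(i, j). \<beta> ! i ^ (j + 1))) = Some W)"
  using assms by (induction rule: mrank_loop.induct) auto

text \<open>The exponents start at 1, so a zero root gives a zero row, and such a matrix has no
  inverse. This is where the algorithm excludes the ratio 0.\<close>

lemma power_matrix_nonzero:
  fixes \<beta> :: "complex list"
  assumes "mat_inverse (Matrix.mat r r (\<lambda>(i, j). \<beta> ! i ^ (j + 1))) = Some W" "i < r"
  shows "\<beta> ! i \<noteq> 0"
proof
  assume zero: "\<beta> ! i = 0"
  let ?M = "Matrix.mat r r (\<lambda>(i, j). \<beta> ! i ^ (j + 1))"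
  have "?M * W = 1\<^sub>m r" "W \<in> carrier_mat r r"
    using mat_inverse(2)[OF _ assms(1), of r] by auto
  then have "(?M * W) $$ (i, i) = 1"
    using assms(2) by simp
  moreover have "(?M * W) $$ (i, i) = 0"
    using assms(2) \<open>W \<in> carrier_mat r r\<close> zero by (auto simp: scalar_prod_def intro!: sum.neutral)
  ultimately show False
    by simp
qed

proposition moment_rank_iff_mrank:
  assumes "r \<ge> 1"
  shows "has_moment_rank c r \<longleftrightarrow> (\<exists>\<alpha>. mrank c (Returned r \<alpha>))"
proof -
  obtain m where m: "r = Suc m"
    using assms by (cases r) auto
  show ?thesis
  proof
    assume "has_moment_rank c r"
    then obtain S w where S: "exp_rep c S w" "card S = r"
      using has_moment_rank_iff[OF assms] by blast
    then obtain \<alpha> where "mrank_loop c (card S) (Returned r \<alpha>)"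
      using exp_rep_mrank_loop_returned[OF S(1), of m] m by auto
    then show "\<exists>\<alpha>. mrank c (Returned r \<alpha>)"
      using exp_rep_mrank[OF S(1), of 1] S(2) assms unfolding mrank_def by blast
  next
    assume "\<exists>\<alpha>. mrank c (Returned r \<alpha>)"
    then obtain \<alpha> where "mrank_loop c 1 (Returned r \<alpha>)"
      by (auto simp: mrank_def)
    from mrank_loop_returned[OF this refl] obtain \<beta> W where L:
      "Determinant.det (mrank_mat c r) \<noteq> 0" "satisfies_recurrence c r (mrank_coeff c r)"
      "\<not> has_repeated_root (mrank_poly c r)" "distinct \<beta>"
      "set \<beta> = {z. poly (mrank_poly c r) z = 0}"
      "mat_inverse (Matrix.mat r r (\<lambda>(i, j). \<beta> ! i ^ (j + 1))) = Some W"
      by blast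
    define p where "p = mrank_poly c r"
    have ann: "annihilates p c" and sf: "rsquarefree p" and deg: "degree p = r"
      using L(2,3) mrank_poly_monic(1)[of c r] not_has_repeated_root_iff
      by (auto simp: p_def satisfies_recurrence_mrank_coeff_iff)
    have len: "length \<beta> = r"
      using rsquarefree_card_roots[OF sf] L(4,5) deg distinct_card[of \<beta>] by (simp add: p_def)
    have p0: "poly p 0 \<noteq> 0"
    proof
      assume "poly p 0 = 0"
      then have "0 \<in> set \<beta>"
        using L(5) by (simp add: p_def)
      then show False
        using power_matrix_nonzero[OF L(6)] len by (metis in_set_conv_nth)
    qed
    \<comment> \<open>The determinant test passed at the exit value r certifies the minimality of
      \<open>p\<close>.\<close>
    have min: "degree p \<le> degree q" if "q \<noteq> 0" "annihilates q c" for q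
    proof (rule ccontr)
      assume "\<not> degree p \<le> degree q"
      then have "degree q \<le> m"
        using deg m by simp
      then have "Determinant.det (hankel c m 0) = 0"
        unfolding det_hankel_eq_0_iff using that by (auto simp: annihilates_def)
      then show False
        using L(1) by (simp add: m mrank_mat_eq_hankel)
    qed
    obtain S w where "exp_rep c S w" "card S = degree p"
      using minimal_annihilates_imp_exp_rep[OF ann sf p0 min] .
    then show "has_moment_rank c r"
      using has_moment_rank_iff[OF assms] deg by blast
  qed
qed

section \<open>The equivalences\<close>

theorem theorem1:
  fixes c :: "nat \<Rightarrow> complex" and r :: nat
  assumes "r \<ge> 1"
  shows
    "(has_moment_rank c r \<longleftrightarrow>
        (\<exists>n. c n \<noteq> 0) \<and>
        satisfies_simple_recurrence c r \<and>
        (\<forall>s>0. satisfies_simple_recurrence c s \<longrightarrow> r \<le> s)) \<and>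
     (has_moment_rank c r \<longleftrightarrow>
        (\<forall>t. Determinant.det (hankel c (r - 1) t) \<noteq> 0) \<and>
        kernel_dim (hankel c r 0) = 1 \<and>
        (\<forall>t. mat_kernel (hankel c r t) = mat_kernel (hankel c r 0)) \<and>
        \<not> vec_coords ` mat_kernel (hankel c r 0) \<subseteq> discriminant_variety r) \<and>
     (has_moment_rank c r \<longleftrightarrow>
        (\<exists>\<alpha> \<beta> l :: nat \<Rightarrow> complex.
           (\<forall>j\<in>{1..r}. \<alpha> j \<noteq> 0 \<and> \<beta> j \<noteq> 0 \<and> l j \<noteq> 0) \<and>
           (\<forall>t. (\<Sum>j=0..2*r. poly_const (of_nat ((2*r) choose j) * c (j + t)) *
                     poly_x ^ (2*r - j) * poly_y ^ j) =
                (\<Sum>j=1..r. poly_const (l j * (\<beta> j / \<alpha> j) ^ t) *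
                     (poly_const (\<alpha> j) * poly_x + poly_const (\<beta> j) * poly_y) ^ (2*r))) \<and>
           inj_on (\<lambda>j. \<alpha> j / \<beta> j) {1..r})) \<and>
     (has_moment_rank c r \<longleftrightarrow>
        (\<exists>\<Phi>. \<Phi> has_fps_expansion Abs_fps c \<and> rational_function \<Phi> \<and>
           (\<Phi> \<longlongrightarrow> 0) at_infinity \<and> exactly_simple_poles \<Phi> r)) \<and>
     (has_moment_rank c r \<longleftrightarrow>
        has_rank_inf (hankel_inf c) r \<and>
        nondegenerate_vandermonde_decomposition (hankel_inf c)) \<and>
     (has_moment_rank c r \<longleftrightarrow>
        radical_ideal (recurrence_ideal c) \<and>
        (\<exists>p\<in>recurrence_ideal c. poly p 0 \<noteq> 0) \<and>
        (\<exists>p\<in>recurrence_ideal c. p \<noteq> 0 \<and> degree p = r) \<and>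
        (\<forall>p\<in>recurrence_ideal c. p \<noteq> 0 \<longrightarrow> r \<le> degree p)) \<and>
     (has_moment_rank c r \<longleftrightarrow>
        (\<exists>\<mu>. complex_measure borel \<mu> \<and> atomic_measure borel \<mu> r \<and> \<mu> {0} = 0 \<and>
             moment_sequence_of \<mu> c)) \<and>
     (has_moment_rank c r \<longleftrightarrow>
        (\<exists>\<alpha>. mrank c (Returned r \<alpha>)))"
  by (intro conjI moment_rank_iff_recurrence moment_rank_iff_hankel moment_rank_iff_forms
      moment_rank_iff_generating_function moment_rank_iff_rank_vandermonde
      moment_rank_iff_radical_ideal moment_rank_iff_atomic_measure moment_rank_iff_mrank assms)

end
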